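(* Let $G$ be an infinite, finitely-generated (discrete) group, with finite, symmetric generating set $X$. Let $\omega$ be a radial weight on $G$ with respect to $X$, and, for $n\in\mathbb{N}$, write $\tau_n$ for the value that $\omega$ takes on $S_n$, the set of elements of $G$ of word-length exactly $n$ with respect to $X$. Then $\ell^{1}_{0}(G,\omega)$ is finitely-generated as a left ideal of $\ell^1(G,\omega)$ if and only if $(\tau_n)$ is tail-preserving.
   Context: $\mathbb{N}=\{1,2,\ldots\}$. A weight on a group $G$ with identity $e$ is a function $\omega:G\to[1,\infty)$ with $\omega(uv)\le\omega(u)\omega(v)$ for all $u,v\in G$ and $\omega(e)=1$. $X$ is symmetric if $X=X^{-1}$. The weight $\omega$ is radial with respect to the generating set $X$ if $\omega(u)=\omega(v)$ whenever $u,v$ have the same word-length with respect to $X$. $\ell^1(G,\omega)$ is the set of $f:G\to\mathbb{C}$ with $\|f\|_\omega=\sum_{u\in G}|f(u)|\omega(u)<\infty$, a unital Banach algebra under convolution. The augmentation ideal is $\ell^1_0(G,\omega)=\{f\in\ell^1(G,\omega):\sum_{u\in G}f(u)=0\}$. A left ideal $I$ of a unital algebra $A$ is finitely-generated if there exist $n\in\mathbb{N}$ and $x_1,\ldots,x_n\in A$ with $I=Ax_1+\cdots+Ax_n$ (purely algebraically, no closure is taken). A sequence $(\tau_n)_{n\in\mathbb{N}}\subset[1,\infty)$ is tail-preserving if, for each sequence of complex numbers $(x_n)$, $\sum_{n=1}^\infty\tau_n|x_n|<\infty$ implies $\sum_{n=1}^\infty\tau_n\left|\sum_{j=n+1}^\infty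 x_j\right|<\infty$. *)

theory Defs
  imports "HOL-Algebra.Generated_Groups" "HOL-Algebra.AbelCoset" "HOL-Analysis.Infinite_Sum"
begin

definition weight :: "('a, 'b) monoid_scheme \<Rightarrow> ('a \<Rightarrow> real) \<Rightarrow> bool" where
  "weight G \<omega> \<longleftrightarrow>
     (\<forall>u\<in>carrier G. 1 \<le> \<omega> u) \<and>
     (\<forall>u\<in>carrier G. \<forall>v\<in>carrier G. \<omega> (u \<otimes>\<^bsub>G\<^esub> v) \<le> \<omega> u * \<omega> v) \<and>
     \<omega> \<one>\<^bsub>G\<^esub> = 1"

(* Inverses of letters are not adjoined here: word_length is only used for symmetric X.
   The identity is represented by the empty word, so it has length 0. *)
definition word_length :: "('a, 'b) monoid_scheme \<Rightarrow> 'a set \<Rightarrow> 'a \<Rightarrow> nat" where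
  "word_length G X u =
     (LEAST n. \<exists>ws. set ws \<subseteq> X \<and> length ws = n \<and> foldr (\<lambda>x y. x \<otimes>\<^bsub>G\<^esub> y) ws \<one>\<^bsub>G\<^esub> = u)"

definition word_sphere :: "('a, 'b) monoid_scheme \<Rightarrow> 'a set \<Rightarrow> nat \<Rightarrow> 'a set" where
  "word_sphere G X n = {u \<in> carrier G. word_length G X u = n}"

definition radial :: "('a, 'b) monoid_scheme \<Rightarrow> 'a set \<Rightarrow> ('a \<Rightarrow> real) \<Rightarrow> bool" where
  "radial G X \<omega> \<longleftrightarrow>
     (\<forall>u\<in>carrier G. \<forall>v\<in>carrier G. word_length G X u = word_length G X v \<longrightarrow> \<omega> u = \<omega> v)"

(* Functions on the group are represented by functions on the ambient type that vanish
   outside the carrier, so that equality of functions is equality on the carrier. *)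
definition l1 :: "('a, 'b) monoid_scheme \<Rightarrow> ('a \<Rightarrow> real) \<Rightarrow> ('a \<Rightarrow> complex) set" where
  "l1 G \<omega> = {f. (\<forall>u. u \<notin> carrier G \<longrightarrow> f u = 0) \<and>
                (\<lambda>u. cmod (f u) * \<omega> u) summable_on carrier G}"

definition convolution ::
  "('a, 'b) monoid_scheme \<Rightarrow> ('a \<Rightarrow> complex) \<Rightarrow> ('a \<Rightarrow> complex) \<Rightarrow> 'a \<Rightarrow> complex" where
  "convolution G f g =
     (\<lambda>u. if u \<in> carrier G
           then \<Sum>\<^sub>\<infinity>v\<in>carrier G. f v * g (inv\<^bsub>G\<^esub> v \<otimes>\<^bsub>G\<^esub> u)
           else 0)"

definition l1_algebra ::
  "('a, 'b) monoid_scheme \<Rightarrow> ('a \<Rightarrow> real) \<Rightarrow> ('a \<Rightarrow> complex) ring" where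
  "l1_algebra G \<omega> =
     \<lparr>carrier = l1 G \<omega>,
      monoid.mult = convolution G,
      one = (\<lambda>u. if u = \<one>\<^bsub>G\<^esub> then 1 else 0),
      zero = (\<lambda>u. 0),
      add = (\<lambda>f g u. f u + g u)\<rparr>"

definition augmentation_ideal ::
  "('a, 'b) monoid_scheme \<Rightarrow> ('a \<Rightarrow> real) \<Rightarrow> ('a \<Rightarrow> complex) set" where
  "augmentation_ideal G \<omega> = {f \<in> l1 G \<omega>. (\<Sum>\<^sub>\<infinity>u\<in>carrier G. f u) = 0}"

definition left_ideal :: "'a set \<Rightarrow> ('a, 'b) ring_scheme \<Rightarrow> bool" where
  "left_ideal I A \<longleftrightarrow>
     additive_subgroup I A \<and> (\<forall>a\<in>carrier A. \<forall>x\<in>I. a \<otimes>\<^bsub>A\<^esub> x \<in> I)"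

(* A is meant to be unital, so A x1 + ... + A xn contains the generators and, for an
   algebra over a field, is automatically a linear subspace. *)
definition finitely_generated_left_ideal :: "'a set \<Rightarrow> ('a, 'b) ring_scheme \<Rightarrow> bool" where
  "finitely_generated_left_ideal I A \<longleftrightarrow>
     left_ideal I A \<and>
     (\<exists>n\<ge>1. \<exists>x \<in> {1..n::nat} \<rightarrow> carrier A.
        I = {(\<Oplus>\<^bsub>A\<^esub>i\<in>{1..n}. a i \<otimes>\<^bsub>A\<^esub> x i) | a. a \<in> {1..n} \<rightarrow> carrier A})"

(* Sequences are indexed by {1..}; the values at 0 play no role.  As tau is at least 1,
   the hypothesis makes x absolutely summable, so the unordered sum over {n+1..} is the
   sum of the series. *)
definition tail_preserving :: "(nat \<Rightarrow> real) \<Rightarrow> bool" where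
  "tail_preserving \<tau> \<longleftrightarrow>
     (\<forall>n\<ge>1. 1 \<le> \<tau> n) \<and>
     (\<forall>x :: nat \<Rightarrow> complex.
        (\<lambda>n. \<tau> n * cmod (x n)) summable_on {1..} \<longrightarrow>
        (\<lambda>n. \<tau> n * cmod (\<Sum>\<^sub>\<infinity>j\<in>{n+1..}. x j)) summable_on {1..})"

end

theory Submission
  imports Defs
begin

text \<open>
  Write \<open>S m\<close> for the sum of \<open>\<tau> n\<close> over \<open>1 \<le> n < m\<close>. Both sides of the equivalence amount to a bound
  \<open>S m \<le> C * \<tau> m\<close> for all \<open>m \<ge> 1\<close>.

  For tail preservation this is an exchange of summation: a summable \<open>x\<close> satisfies
  \<open>\<Sum>n. \<tau> n * \<bar>\<Sum>j>n. x j\<bar> \<le> \<Sum>j. \<bar>x j\<bar> * S j\<close>. If no such \<open>C\<close> exists, a nonnegative \<open>x\<close> that is heavy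
  along indices with \<open>S j / \<tau> j\<close> growing geometrically makes the left-hand side diverge.

  Suppose that the bound holds. The generators are the elements \<open>\<delta>\<^sub>e - \<delta>\<^sub>x\<close> with \<open>x\<close> in \<open>X\<close>. Choosing for
  every group element a neighbour that is one step closer to the identity makes the Cayley graph
  into a geodesic tree. An element \<open>f\<close> of the augmentation ideal is the divergence of the flow that
  carries each mass \<open>f g\<close> along the tree from \<open>g\<close> to the identity, and a flow along edges labelled
  by letters is exactly a combination of the generators. The path from \<open>g\<close> has weight
  \<open>\<tau> 1 + ... + \<tau> m\<close>, where \<open>m\<close> is the length of \<open>g\<close>, so this flow has finite weighted norm by the
  bound (\<open>subtree_sum_l1\<close>, \<open>flow_decomposition\<close>).

  Conversely, let \<open>h\<^sub>1, ..., h\<^sub>n\<close> be arbitrary generators, and suppose that \<open>S m / \<tau> m\<close> is unbounded. Pair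
  functions on the group with the truncated height \<open>min (S \<bar>u\<bar>) L\<close>, and let \<open>D\<close> be the norm of this
  functional. Heights of neighbours differ by at most a multiple of the weight, independently of \<open>L\<close>, so on \<open>a * h\<close>,
  where \<open>h\<close> has total mass zero and is almost finitely supported, the functional is bounded by
  \<open>\<parallel>a\<parallel> * (C + \<epsilon> * D)\<close> with arbitrarily small \<open>\<epsilon>\<close> and \<open>C\<close> depending on \<open>h\<close> and \<open>\<epsilon>\<close> alone
  (\<open>truncated_height_pairing_bound\<close>). Hence on every fixed element of the ideal it is of smaller
  order than \<open>D\<close>, at a rate that depends only on the generators. Truncations with \<open>D\<close> as large as
  desired have points at which the norm \<open>D\<close> is nearly attained. A single nonnegative function with
  geometrically decaying mass on a sequence of such points, corrected at the identity to have total
  mass zero, violates that rate. Positivity excludes cancellation and makes the open mapping theorem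
  dispensable.
\<close>

section \<open>Tail-preserving sequences\<close>

definition lower_sum :: "(nat \<Rightarrow> real) \<Rightarrow> nat \<Rightarrow> real" where
  "lower_sum \<tau> m = (\<Sum>n\<in>{1..<m}. \<tau> n)"

lemma has_sum_finite_sum:
  fixes f :: "'i \<Rightarrow> 'c \<Rightarrow> 'd::topological_comm_monoid_add"
  assumes "finite F" "\<And>i. i \<in> F \<Longrightarrow> (f i has_sum s i) A"
  shows "((\<lambda>x. \<Sum>i\<in>F. f i x) has_sum (\<Sum>i\<in>F. s i)) A"
  using assms by (induction F rule: finite_induct) (auto intro: has_sum_add)

text \<open>
  The test functions of both contradiction arguments. As \<open>g\<close> may repeat values, the masses
  \<open>(1/2) ^ k\<close> of all \<open>k\<close> with the same \<open>g k\<close> are added up.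
\<close>

lemma weighted_summable_slowly_along_sequence:
  fixes g :: "nat \<Rightarrow> 'c" and w :: "'c \<Rightarrow> real"
  assumes "\<And>k. g k \<in> A" and w: "\<And>u. u \<in> A \<Longrightarrow> 1 \<le> w u"
  shows "\<exists>y :: 'c \<Rightarrow> real. (\<forall>u. 0 \<le> y u) \<and> (\<lambda>u. y u * w u) summable_on A \<and>
           (\<forall>u. u \<notin> range g \<longrightarrow> y u = 0) \<and> (\<forall>k. (1/2) ^ k \<le> y (g k) * w (g k))"
proof -
  define mass where "mass u = (\<Sum>\<^sub>\<infinity>k\<in>{k. g k = u}. (1/2::real) ^ k)" for u
  define y where "y u = (if u \<in> A then mass u / w u else 0)" for u
  have geo: "(\<lambda>k. (1/2::real) ^ k) summable_on UNIV"
    by (rule summable_nonneg_imp_summable_on) (auto intro: summable_geometric)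
  have fib: "(\<lambda>k. (1/2::real) ^ k) summable_on {k. g k = u}" for u
    by (rule summable_on_subset_banach[OF geo]) auto
  have bij: "bij_betw (\<lambda>k. (g k, k)) UNIV (Sigma A (\<lambda>u. {k. g k = u}))"
    using assms(1) by (auto simp: bij_betw_def inj_on_def)
  have "(\<lambda>(u, k). (1/2::real) ^ k) summable_on Sigma A (\<lambda>u. {k. g k = u})"
    using geo by (subst summable_on_reindex_bij_betw[OF bij, symmetric]) simp
  then have sm: "mass summable_on A"
    unfolding mass_def by (rule summable_on_Sigma_banach)
  have mass0: "0 \<le> mass u" for u
    unfolding mass_def by (rule infsum_nonneg) simp
  have wy: "y u * w u = mass u" if "u \<in> A" for u
    using w[OF that] that by (simp add: y_def)
  have "0 \<le> y u" for u
    using mass0[of u] w[of u] by (auto simp: y_def intro!: divide_nonneg_nonneg)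
  moreover have "(\<lambda>u. y u * w u) summable_on A"
    using sm by (simp add: wy cong: summable_on_cong)
  moreover have "y u = 0" if "u \<notin> range g" for u
  proof -
    have "{k. g k = u} = {}" using that by auto
    then show ?thesis by (simp add: y_def mass_def)
  qed
  moreover have "(1/2) ^ k \<le> y (g k) * w (g k)" for k
  proof -
    have "sum (\<lambda>k. (1/2::real) ^ k) {k} \<le> mass (g k)"
      unfolding mass_def by (rule finite_sum_le_infsum[OF fib]) auto
    then show ?thesis by (simp add: wy assms(1))
  qed
  ultimately show ?thesis by blast
qed

lemma lower_sum_nonneg:
  assumes "\<And>n. n \<ge> 1 \<Longrightarrow> 0 \<le> \<tau> n"
  shows "0 \<le> lower_sum \<tau> m"
  unfolding lower_sum_def using assms by (intro sum_nonneg) auto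

lemma lower_sum_Suc: "lower_sum \<tau> (Suc m) = lower_sum \<tau> m + (if m = 0 then 0 else \<tau> m)"
  unfolding lower_sum_def by (cases "m = 0") auto

text \<open>
  If the bound fails, there are indices \<open>m k\<close> at which the lower sum exceeds \<open>4 ^ k * \<tau> (m k)\<close>. A
  sequence with weighted mass at least \<open>(1/2) ^ k\<close> at \<open>m k\<close> contributes at least \<open>4 ^ k * (1/2) ^ k\<close> to
  the weighted sum of its tails, for every \<open>k\<close>.
\<close>

lemma tail_preserving_imp_lower_sum_bound:
  assumes "tail_preserving \<tau>"
  shows "\<exists>C. \<forall>m\<ge>1. lower_sum \<tau> m \<le> C * \<tau> m"
proof (rule ccontr)
  assume "\<not> ?thesis"
  then have "\<exists>m\<ge>1. 4 ^ k * \<tau> m < lower_sum \<tau> m" for k :: nat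
    by (meson linorder_not_le)
  then obtain m where m1: "\<And>k. 1 \<le> m k" and m: "\<And>k :: nat. 4 ^ k * \<tau> (m k) < lower_sum \<tau> (m k)"
    by metis
  have \<tau>1: "1 \<le> \<tau> n" if "n \<ge> 1" for n
    using assms that by (simp add: tail_preserving_def)
  obtain y where y0: "\<And>j. 0 \<le> y j" and ys: "(\<lambda>j. y j * \<tau> j) summable_on {1..}"
    and ym: "\<And>k. (1/2) ^ k \<le> y (m k) * \<tau> (m k)"
    using weighted_summable_slowly_along_sequence[of m "{1..}" \<tau>] m1 \<tau>1 by auto
  define t where "t n = (\<Sum>\<^sub>\<infinity>j\<in>{n+1..}. y j)" for n :: nat
  have ysum: "y summable_on {n+1..}" for n
  proof (rule summable_on_comparison_test)
    show "(\<lambda>j. y j * \<tau> j) summable_on {n+1..}"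
      by (rule summable_on_subset_banach[OF ys]) auto
    fix j assume "j \<in> {n+1..}"
    then show "y j \<le> y j * \<tau> j"
      using mult_left_mono[OF \<tau>1[of j] y0[of j]] by auto
  qed (rule y0)
  have t0: "0 \<le> t n" for n
    unfolding t_def by (rule infsum_nonneg) (rule y0)
  have "(\<lambda>n. \<tau> n * cmod (complex_of_real (y n))) summable_on {1..}"
    using ys y0 by (simp add: mult.commute)
  then have "(\<lambda>n. \<tau> n * cmod (\<Sum>\<^sub>\<infinity>j\<in>{n+1..}. complex_of_real (y j))) summable_on {1..}"
    using assms[unfolded tail_preserving_def, THEN conjunct2, rule_format, of "\<lambda>n. complex_of_real (y n)"]
    by blast
  moreover have "(\<Sum>\<^sub>\<infinity>j\<in>{n+1..}. complex_of_real (y j)) = complex_of_real (t n)" for n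
    unfolding t_def using has_sum_of_real[OF has_sum_infsum[OF ysum]] by (rule infsumI)
  ultimately have ts: "(\<lambda>n. \<tau> n * t n) summable_on {1..}"
    using t0 by simp
  define M where "M = (\<Sum>\<^sub>\<infinity>n\<in>{1..}. \<tau> n * t n)"
  have "2 ^ k \<le> M" for k
  proof -
    have le: "y (m k) \<le> t n" if "n < m k" for n
    proof -
      have "sum y {m k} \<le> t n"
        unfolding t_def using that by (intro finite_sum_le_infsum[OF ysum]) (auto simp: y0)
      then show ?thesis by simp
    qed
    have "(2::real) ^ k = 4 ^ k * (1/2) ^ k"
      by (simp flip: power_mult_distrib)
    also have "\<dots> \<le> 4 ^ k * (y (m k) * \<tau> (m k))"
      using ym[of k] by (intro mult_left_mono) auto
    also have "\<dots> = y (m k) * (4 ^ k * \<tau> (m k))"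
      by simp
    also have "\<dots> \<le> y (m k) * lower_sum \<tau> (m k)"
      using m[of k] y0 by (intro mult_left_mono) auto
    also have "\<dots> = (\<Sum>n\<in>{1..<m k}. \<tau> n * y (m k))"
      by (simp add: lower_sum_def sum_distrib_left mult.commute)
    also have "\<dots> \<le> (\<Sum>n\<in>{1..<m k}. \<tau> n * t n)"
      by (rule sum_mono, rule mult_left_mono) (use le \<tau>1 in \<open>auto intro: order_trans[OF zero_le_one]\<close>)
    also have "\<dots> \<le> M"
      unfolding M_def
      by (rule finite_sum_le_infsum[OF ts]) (use \<tau>1 t0 in \<open>auto intro!: mult_nonneg_nonneg intro: order_trans[OF zero_le_one]\<close>)
    finally show ?thesis .
  qed
  moreover obtain k where "M < 2 ^ k"
    using real_arch_pow[of 2 M] by auto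
  ultimately show False by (meson linorder_not_le)
qed

text \<open>
  In the weighted sum of the tails the term \<open>x j\<close> is counted with total weight \<open>lower_sum \<tau> j\<close>, once
  for every \<open>n < j\<close>.
\<close>

lemma lower_sum_bound_imp_tail_preserving:
  assumes \<tau>1: "\<And>n. n \<ge> 1 \<Longrightarrow> 1 \<le> \<tau> n"
    and C: "\<And>m. m \<ge> 1 \<Longrightarrow> lower_sum \<tau> m \<le> C * \<tau> m"
  shows "tail_preserving \<tau>"
  unfolding tail_preserving_def
proof (intro conjI allI impI)
  fix x :: "nat \<Rightarrow> complex"
  assume xs: "(\<lambda>n. \<tau> n * cmod (x n)) summable_on {1..}"
  have \<tau>0: "0 \<le> \<tau> n" if "n \<ge> 1" for n
    using \<tau>1[OF that] by simp
  have xabs: "(\<lambda>j. cmod (x j)) summable_on {n+1..}" for n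
  proof (rule summable_on_comparison_test)
    show "(\<lambda>j. \<tau> j * cmod (x j)) summable_on {n+1..}"
      by (rule summable_on_subset_banach[OF xs]) auto
    fix j assume "j \<in> {n+1..}"
    then show "cmod (x j) \<le> \<tau> j * cmod (x j)"
      using mult_right_mono[OF \<tau>1[of j], of "cmod (x j)"] by auto
  qed simp
  have ls: "(\<lambda>j. \<tau> n * cmod (x j) * of_bool (n < j)) summable_on {1..}" if "n \<ge> 1" for n
  proof (rule summable_on_comparison_test)
    show "(\<lambda>j. \<tau> n * cmod (x j)) summable_on {1..}"
      using xabs[of 0] by (simp add: summable_on_cmult_right)
  qed (use \<tau>0 that in auto)
  show "(\<lambda>n. \<tau> n * cmod (\<Sum>\<^sub>\<infinity>j\<in>{n+1..}. x j)) summable_on {1..}"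
  proof (rule nonneg_bdd_above_summable_on)
    show "0 \<le> \<tau> n * cmod (\<Sum>\<^sub>\<infinity>j\<in>{n+1..}. x j)" if "n \<in> {1..}" for n
      using \<tau>0 that by simp
    show "bdd_above (sum (\<lambda>n. \<tau> n * cmod (\<Sum>\<^sub>\<infinity>j\<in>{n+1..}. x j)) ` {F. F \<subseteq> {1..} \<and> finite F})"
    proof (rule bdd_aboveI2)
      fix F :: "nat set" assume "F \<in> {F. F \<subseteq> {1..} \<and> finite F}"
      then have F: "F \<subseteq> {1..}" "finite F" by auto
      \<comment> \<open>Only finitely many tails are exchanged with the infinite sum at a time.\<close>
      have sw: "((\<lambda>j. \<Sum>n\<in>F. \<tau> n * cmod (x j) * of_bool (n < j)) has_sum
          (\<Sum>n\<in>F. \<Sum>\<^sub>\<infinity>j\<in>{1..}. \<tau> n * cmod (x j) * of_bool (n < j))) {1..}"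
        by (rule has_sum_finite_sum[OF F(2)], rule has_sum_infsum, rule ls) (use F in auto)
      have "(\<Sum>n\<in>F. \<tau> n * cmod (\<Sum>\<^sub>\<infinity>j\<in>{n+1..}. x j))
          \<le> (\<Sum>n\<in>F. \<Sum>\<^sub>\<infinity>j\<in>{1..}. \<tau> n * cmod (x j) * of_bool (n < j))"
      proof (rule sum_mono)
        fix n assume "n \<in> F"
        then have n: "n \<ge> 1" using F by auto
        have "\<tau> n * cmod (\<Sum>\<^sub>\<infinity>j\<in>{n+1..}. x j) \<le> \<tau> n * (\<Sum>\<^sub>\<infinity>j\<in>{n+1..}. cmod (x j))"
          using xabs[of n] \<tau>0[OF n] by (intro mult_left_mono norm_infsum_bound) auto
        also have "\<dots> = (\<Sum>\<^sub>\<infinity>j\<in>{n+1..}. \<tau> n * cmod (x j))"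
          by (simp add: infsum_cmult_right')
        also have "\<dots> = (\<Sum>\<^sub>\<infinity>j\<in>{1..}. \<tau> n * cmod (x j) * of_bool (n < j))"
          by (rule infsum_cong_neutral) (auto simp: not_less_eq_eq)
        finally show "\<tau> n * cmod (\<Sum>\<^sub>\<infinity>j\<in>{n+1..}. x j)
            \<le> (\<Sum>\<^sub>\<infinity>j\<in>{1..}. \<tau> n * cmod (x j) * of_bool (n < j))" .
      qed
      also have "\<dots> = (\<Sum>\<^sub>\<infinity>j\<in>{1..}. \<Sum>n\<in>F. \<tau> n * cmod (x j) * of_bool (n < j))"
        by (rule infsumI[OF sw, symmetric])
      also have "\<dots> \<le> (\<Sum>\<^sub>\<infinity>j\<in>{1..}. C * (\<tau> j * cmod (x j)))"
      proof (rule infsum_mono)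
        show "(\<lambda>j. \<Sum>n\<in>F. \<tau> n * cmod (x j) * of_bool (n < j)) summable_on {1..}"
          by (rule has_sum_imp_summable[OF sw])
        show "(\<lambda>j. C * (\<tau> j * cmod (x j))) summable_on {1..}"
          by (rule summable_on_cmult_right[OF xs])
        fix j :: nat assume "j \<in> {1..}"
        then have j: "j \<ge> 1" by simp
        have "(\<Sum>n\<in>F. \<tau> n * cmod (x j) * of_bool (n < j)) = (\<Sum>n\<in>F \<inter> {1..<j}. \<tau> n) * cmod (x j)"
          unfolding sum_distrib_right
          by (rule sum.mono_neutral_cong_right) (use F in auto)
        also have "\<dots> \<le> lower_sum \<tau> j * cmod (x j)"
          unfolding lower_sum_def by (intro mult_right_mono sum_mono2) (auto simp: \<tau>0)
        also have "\<dots> \<le> C * \<tau> j * cmod (x j)"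
          by (intro mult_right_mono C j) simp
        finally show "(\<Sum>n\<in>F. \<tau> n * cmod (x j) * of_bool (n < j)) \<le> C * (\<tau> j * cmod (x j))"
          by (simp add: mult.assoc)
      qed
      finally show "(\<Sum>n\<in>F. \<tau> n * cmod (\<Sum>\<^sub>\<infinity>j\<in>{n+1..}. x j))
          \<le> (\<Sum>\<^sub>\<infinity>j\<in>{1..}. C * (\<tau> j * cmod (x j)))" .
    qed
  qed
qed (rule \<tau>1)

section \<open>Word length in a finitely generated group\<close>

locale finitely_generated_group = group G for G (structure) +
  fixes X :: "'a set"
  assumes letters_in_carrier: "X \<subseteq> carrier G"
    and finite_letters: "finite X"
    and symmetric_letters: "set_inv X = X"
    and letters_generate: "generate G X = carrier G"
begin

abbreviation len :: "'a \<Rightarrow> nat" where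
  "len \<equiv> word_length G X"

abbreviation word_value :: "'a list \<Rightarrow> 'a" where
  "word_value ws \<equiv> foldr (\<lambda>x y. x \<otimes> y) ws \<one>"

lemma letter_closed [simp]: "x \<in> X \<Longrightarrow> x \<in> carrier G"
  using letters_in_carrier by auto

lemma inv_letter: "x \<in> X \<Longrightarrow> inv x \<in> X"
  using symmetric_letters by (auto simp: SET_INV_def)

lemma word_value_closed [simp]: "set ws \<subseteq> X \<Longrightarrow> word_value ws \<in> carrier G"
  by (induction ws) auto

lemma word_value_append:
  assumes "set us \<subseteq> X" "set vs \<subseteq> X"
  shows "word_value (us @ vs) = word_value us \<otimes> word_value vs"
  using assms by (induction us) (auto simp: m_assoc)

text \<open>
  Symmetry of \<open>X\<close> enters here: inverses of letters are letters, so positive words suffice.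
\<close>

lemma ex_word:
  assumes "u \<in> carrier G"
  shows "\<exists>ws. set ws \<subseteq> X \<and> word_value ws = u"
proof -
  have "u \<in> generate G X"
    using assms letters_generate by simp
  then show ?thesis
  proof induction
    case one
    show ?case by (rule exI[of _ "[]"]) simp
  next
    case (incl h)
    then show ?case by (intro exI[of _ "[h]"]) simp
  next
    case (inv h)
    then show ?case using inv_letter[OF inv] by (intro exI[of _ "[inv h]"]) simp
  next
    case (eng h1 h2)
    then obtain us vs where "set us \<subseteq> X" "word_value us = h1" "set vs \<subseteq> X" "word_value vs = h2"
      by blast
    then show ?case using word_value_append[of us vs] by (intro exI[of _ "us @ vs"]) auto
  qed
qed

lemma ex_geodesic_word:
  assumes "u \<in> carrier G"
  shows "\<exists>ws. set ws \<subseteq> X \<and> length ws = len u \<and> word_value ws = u"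
  unfolding word_length_def by (rule LeastI_ex) (use ex_word[OF assms] in blast)

lemma len_word_value_le: "set ws \<subseteq> X \<Longrightarrow> len (word_value ws) \<le> length ws"
  unfolding word_length_def by (rule Least_le) blast

lemma len_one [simp]: "len \<one> = 0"
  using len_word_value_le[of "[]"] by simp

lemma len_eq_0_iff: "u \<in> carrier G \<Longrightarrow> len u = 0 \<longleftrightarrow> u = \<one>"
  using ex_geodesic_word[of u] by auto

lemma len_mult_letter_le:
  assumes "u \<in> carrier G" "x \<in> X"
  shows "len (u \<otimes> x) \<le> Suc (len u)"
proof -
  obtain ws where "set ws \<subseteq> X" "length ws = len u" "word_value ws = u"
    using ex_geodesic_word[OF assms(1)] by blast
  then show ?thesis
    using len_word_value_le[of "ws @ [x]"] word_value_append[of ws "[x]"] assms by simp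
qed

lemma len_le_mult_letter:
  assumes "u \<in> carrier G" "x \<in> X"
  shows "len u \<le> Suc (len (u \<otimes> x))"
  using len_mult_letter_le[of "u \<otimes> x" "inv x"] assms inv_letter[of x]
  by (simp add: m_assoc)

lemma ex_descending_letter:
  assumes "u \<in> carrier G" "u \<noteq> \<one>"
  shows "\<exists>x\<in>X. Suc (len (u \<otimes> x)) = len u"
proof -
  obtain ws where ws: "set ws \<subseteq> X" "length ws = len u" "word_value ws = u"
    using ex_geodesic_word[OF assms(1)] by blast
  with assms(2) have "ws \<noteq> []" by auto
  then obtain vs y where vs: "ws = vs @ [y]"
    by (metis append_butlast_last_id)
  with ws have y: "y \<in> X" "set vs \<subseteq> X" by auto
  have "u = word_value vs \<otimes> y"
    using ws vs y word_value_append[of vs "[y]"] by simp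
  then have "u \<otimes> inv y = word_value vs"
    using y by (simp add: m_assoc)
  then have "Suc (len (u \<otimes> inv y)) \<le> len u"
    using len_word_value_le[OF y(2)] ws vs by simp
  moreover have "len u \<le> Suc (len (u \<otimes> inv y))"
    using len_le_mult_letter assms inv_letter y by blast
  ultimately show ?thesis
    using inv_letter y by (intro bexI[of _ "inv y"]) auto
qed

lemma finite_word_ball: "finite {u \<in> carrier G. len u \<le> n}"
proof (rule finite_subset)
  show "{u \<in> carrier G. len u \<le> n} \<subseteq> word_value ` {ws. set ws \<subseteq> X \<and> length ws \<le> n}"
  proof
    fix u assume "u \<in> {u \<in> carrier G. len u \<le> n}"
    then show "u \<in> word_value ` {ws. set ws \<subseteq> X \<and> length ws \<le> n}"
      using ex_geodesic_word[of u] by auto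
  qed
  show "finite (word_value ` {ws. set ws \<subseteq> X \<and> length ws \<le> n})"
    using finite_lists_length_le[OF finite_letters] by blast
qed

text \<open>
  Balls are finite, so an infinite group has elements of arbitrarily large length; descending from
  one of them letter by letter passes through every smaller length.
\<close>

lemma word_sphere_nonempty:
  assumes "infinite (carrier G)"
  shows "\<exists>u\<in>carrier G. len u = n"
proof -
  have "\<exists>u\<in>carrier G. len u = n" if "v \<in> carrier G" "n \<le> len v" for v
    using that
  proof (induction "len v" arbitrary: v)
    case 0
    then show ?case by auto
  next
    case (Suc k)
    show ?case
    proof (cases "n = len v")
      case True
      then show ?thesis using Suc by blast
    next
      case False
      have "v \<noteq> \<one>" using Suc by auto
      then obtain x where x: "x \<in> X" "Suc (len (v \<otimes> x)) = len v"
        using ex_descending_letter Suc by blast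
      then show ?thesis
        using Suc.hyps(1)[of "v \<otimes> x"] Suc.hyps(2) Suc.prems False by simp
    qed
  qed
  moreover have "\<exists>v\<in>carrier G. n \<le> len v"
  proof (rule ccontr)
    assume "\<not> ?thesis"
    then have "carrier G \<subseteq> {u \<in> carrier G. len u \<le> n}" by auto
    then show False using finite_word_ball assms finite_subset by blast
  qed
  ultimately show ?thesis by blast
qed

end

section \<open>The weighted convolution algebra and its augmentation ideal\<close>

locale weighted_group = group G for G (structure) +
  fixes \<omega> :: "'a \<Rightarrow> real"
  assumes weight: "weight G \<omega>"
begin

lemma weight_ge_1: "u \<in> carrier G \<Longrightarrow> 1 \<le> \<omega> u"
  and weight_mult: "u \<in> carrier G \<Longrightarrow> v \<in> carrier G \<Longrightarrow> \<omega> (u \<otimes> v) \<le> \<omega> u * \<omega> v"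
  and weight_one [simp]: "\<omega> \<one> = 1"
  using weight by (auto simp: weight_def)

lemma weight_nonneg: "u \<in> carrier G \<Longrightarrow> 0 \<le> \<omega> u"
  using weight_ge_1[of u] by simp

text \<open>
  Outside \<open>l1 G \<omega>\<close> the defining sum may diverge, and the value is then the default \<open>0\<close>.
\<close>

definition weighted_norm :: "('a \<Rightarrow> complex) \<Rightarrow> real" where
  "weighted_norm f = (\<Sum>\<^sub>\<infinity>u\<in>carrier G. cmod (f u) * \<omega> u)"

abbreviation point :: "'a \<Rightarrow> 'a \<Rightarrow> complex" where
  "point x \<equiv> (\<lambda>u. if u = x then 1 else 0)"

lemma l1_outside: "f \<in> l1 G \<omega> \<Longrightarrow> u \<notin> carrier G \<Longrightarrow> f u = 0"
  by (simp add: l1_def)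

lemma l1_summable: "f \<in> l1 G \<omega> \<Longrightarrow> (\<lambda>u. cmod (f u) * \<omega> u) summable_on carrier G"
  by (simp add: l1_def)

lemma l1I:
  assumes "\<And>u. u \<notin> carrier G \<Longrightarrow> f u = 0" "q summable_on carrier G"
    and "\<And>u. u \<in> carrier G \<Longrightarrow> cmod (f u) * \<omega> u \<le> q u"
  shows "f \<in> l1 G \<omega>"
proof -
  have "(\<lambda>u. cmod (f u) * \<omega> u) summable_on carrier G"
    by (rule summable_on_comparison_test[OF assms(2)]) (auto simp: assms weight_nonneg)
  then show ?thesis using assms by (simp add: l1_def)
qed

lemma weighted_norm_nonneg: "0 \<le> weighted_norm f"
  unfolding weighted_norm_def by (intro infsum_nonneg) (simp add: weight_nonneg)

lemma l1_times_dominated_summable: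
  assumes "f \<in> l1 G \<omega>" and "\<And>u. u \<in> carrier G \<Longrightarrow> cmod (\<phi> u) \<le> B * \<omega> u"
  shows "(\<lambda>u. f u * \<phi> u) abs_summable_on carrier G"
proof (rule summable_on_comparison_test)
  show "(\<lambda>u. B * (cmod (f u) * \<omega> u)) summable_on carrier G"
    by (rule summable_on_cmult_right[OF l1_summable[OF assms(1)]])
  fix u assume "u \<in> carrier G"
  then show "norm (f u * \<phi> u) \<le> B * (cmod (f u) * \<omega> u)"
    using mult_left_mono[OF assms(2)[of u], of "cmod (f u)"] by (simp add: norm_mult ac_simps)
qed simp

lemma l1_abs_summable:
  assumes "f \<in> l1 G \<omega>"
  shows "f abs_summable_on carrier G"
  using l1_times_dominated_summable[OF assms, of "\<lambda>_. 1" 1] weight_ge_1 by simp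

lemma l1_sum_summable: "f \<in> l1 G \<omega> \<Longrightarrow> f summable_on carrier G"
  by (rule abs_summable_summable[OF l1_abs_summable])

lemma l1_zero: "(\<lambda>u. 0) \<in> l1 G \<omega>"
  by (simp add: l1_def)

lemma l1_add:
  assumes "f \<in> l1 G \<omega>" "g \<in> l1 G \<omega>"
  shows "(\<lambda>u. f u + g u) \<in> l1 G \<omega>"
proof (rule l1I)
  show "(\<lambda>u. cmod (f u) * \<omega> u + cmod (g u) * \<omega> u) summable_on carrier G"
    by (intro summable_on_add l1_summable assms)
  fix u assume "u \<in> carrier G"
  then show "cmod (f u + g u) * \<omega> u \<le> cmod (f u) * \<omega> u + cmod (g u) * \<omega> u"
    using mult_right_mono[OF norm_triangle_ineq[of "f u" "g u"] weight_nonneg[of u]]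
    by (simp add: distrib_right)
qed (simp add: l1_outside assms)

lemma l1_scale:
  assumes "f \<in> l1 G \<omega>"
  shows "(\<lambda>u. c * f u) \<in> l1 G \<omega>"
proof (rule l1I)
  show "(\<lambda>u. cmod c * (cmod (f u) * \<omega> u)) summable_on carrier G"
    by (intro summable_on_cmult_right l1_summable assms)
qed (auto simp: l1_outside assms norm_mult)

lemma l1_uminus: "f \<in> l1 G \<omega> \<Longrightarrow> (\<lambda>u. - f u) \<in> l1 G \<omega>"
  using l1_scale[of f "-1"] by simp

lemma l1_diff: "f \<in> l1 G \<omega> \<Longrightarrow> g \<in> l1 G \<omega> \<Longrightarrow> (\<lambda>u. f u - g u) \<in> l1 G \<omega>"
  using l1_add[OF _ l1_uminus, of f g] by simp

lemma has_sum_point: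
  assumes "x \<in> carrier G"
  shows "((\<lambda>u. c * point x u) has_sum c) (carrier G)"
  by (rule has_sum_finite_neutralI[of "{x}"]) (use assms in auto)

lemma l1_point:
  assumes "x \<in> carrier G"
  shows "point x \<in> l1 G \<omega>"
proof -
  have "((\<lambda>u. cmod (point x u) * \<omega> u) has_sum \<omega> x) (carrier G)"
    by (rule has_sum_finite_neutralI[of "{x}"]) (use assms in auto)
  then show ?thesis
    using assms has_sum_imp_summable by (auto simp: l1_def)
qed

lemma bij_left_translate: "v \<in> carrier G \<Longrightarrow> bij_betw (\<lambda>w. v \<otimes> w) (carrier G) (carrier G)"
  by (rule bij_betwI[of _ _ _ "\<lambda>u. inv v \<otimes> u"]) (auto simp flip: m_assoc)

text \<open>
  The substitution \<open>u = v \<otimes> w\<close> turns the pairs into a product of two summable families, and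
  submultiplicativity pays for the weight at \<open>u\<close>. All exchanges of summation for convolutions
  rest on this.
\<close>

lemma convolution_pairs_summable:
  assumes a: "a \<in> l1 G \<omega>" and h: "h \<in> l1 G \<omega>"
  shows "(\<lambda>(v, u). cmod (a v * h (inv v \<otimes> u)) * \<omega> u) summable_on carrier G \<times> carrier G"
proof -
  have "(\<lambda>(v, w). (cmod (a v) * \<omega> v) * (cmod (h w) * \<omega> w)) summable_on carrier G \<times> carrier G"
  proof (rule summable_on_SigmaI)
    show "((\<lambda>w. case (v, w) of (v, w) \<Rightarrow> (cmod (a v) * \<omega> v) * (cmod (h w) * \<omega> w))
        has_sum (cmod (a v) * \<omega> v) * weighted_norm h) (carrier G)" for v
      unfolding weighted_norm_def prod.case
      by (intro has_sum_cmult_right has_sum_infsum l1_summable h)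
    show "(\<lambda>v. (cmod (a v) * \<omega> v) * weighted_norm h) summable_on carrier G"
      by (intro summable_on_cmult_left l1_summable a)
  qed (simp add: weight_nonneg)
  moreover have "bij_betw (\<lambda>(v, u). (v, inv v \<otimes> u)) (carrier G \<times> carrier G) (carrier G \<times> carrier G)"
    by (rule bij_betwI[of _ _ _ "\<lambda>(v, w). (v, v \<otimes> w)"]) (auto simp flip: m_assoc)
  ultimately have s: "(\<lambda>(v, u). (cmod (a v) * \<omega> v) * (cmod (h (inv v \<otimes> u)) * \<omega> (inv v \<otimes> u)))
      summable_on carrier G \<times> carrier G"
    by (subst (asm) summable_on_reindex_bij_betw[symmetric]) (auto simp: case_prod_unfold)
  show ?thesis
  proof (rule summable_on_comparison_test[OF s])
    fix p assume "p \<in> carrier G \<times> carrier G"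
    then obtain v u where p: "p = (v, u)" and v: "v \<in> carrier G" and u: "u \<in> carrier G"
      by auto
    show "0 \<le> (case p of (v, u) \<Rightarrow> cmod (a v * h (inv v \<otimes> u)) * \<omega> u)"
      using p u weight_nonneg by simp
    have "\<omega> u = \<omega> (v \<otimes> (inv v \<otimes> u))"
      using v u by (simp flip: m_assoc)
    also have "\<dots> \<le> \<omega> v * \<omega> (inv v \<otimes> u)"
      using weight_mult v u by simp
    finally have "cmod (a v * h (inv v \<otimes> u)) * \<omega> u
        \<le> cmod (a v * h (inv v \<otimes> u)) * (\<omega> v * \<omega> (inv v \<otimes> u))"
      by (rule mult_left_mono) simp
    then show "(case p of (v, u) \<Rightarrow> cmod (a v * h (inv v \<otimes> u)) * \<omega> u)
        \<le> (case p of (v, u) \<Rightarrow> (cmod (a v) * \<omega> v) * (cmod (h (inv v \<otimes> u)) * \<omega> (inv v \<otimes> u)))"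
      by (simp add: p norm_mult ac_simps)
  qed
qed

lemma convolution_l1:
  assumes a: "a \<in> l1 G \<omega>" and h: "h \<in> l1 G \<omega>"
  shows "convolution G a h \<in> l1 G \<omega>"
proof (rule l1I)
  let ?k = "\<lambda>u v. cmod (a v * h (inv v \<otimes> u)) * \<omega> u"
  have s: "(\<lambda>(u, v). ?k u v) summable_on carrier G \<times> carrier G"
    using convolution_pairs_summable[OF assms] by (subst (asm) summable_on_swap) simp
  then show "(\<lambda>u. \<Sum>\<^sub>\<infinity>v\<in>carrier G. ?k u v) summable_on carrier G"
    by (rule summable_on_Sigma_banach)
  fix u assume u: "u \<in> carrier G"
  have k: "?k u summable_on carrier G"
    by (rule summable_on_SigmaD1[OF s u])
  have "(\<lambda>v. inverse (\<omega> u) * ?k u v) summable_on carrier G"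
    by (rule summable_on_cmult_right[OF k])
  moreover have "\<omega> u \<noteq> 0" using weight_ge_1[OF u] by auto
  ultimately have "(\<lambda>v. a v * h (inv v \<otimes> u)) abs_summable_on carrier G"
    by (simp add: field_simps)
  then have "cmod (\<Sum>\<^sub>\<infinity>v\<in>carrier G. a v * h (inv v \<otimes> u)) \<le> (\<Sum>\<^sub>\<infinity>v\<in>carrier G. cmod (a v * h (inv v \<otimes> u)))"
    by (rule norm_infsum_bound)
  then show "cmod (convolution G a h u) * \<omega> u \<le> (\<Sum>\<^sub>\<infinity>v\<in>carrier G. ?k u v)"
    using u by (simp add: convolution_def infsum_cmult_left' mult_right_mono weight_nonneg)
qed (simp add: convolution_def)

text \<open>
  Pairing with a dominated function \<open>\<phi>\<close> superposes left translates of \<open>h\<close>. With \<open>\<phi> = 1\<close> it says that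
  the augmentation is multiplicative.
\<close>

lemma convolution_pairing:
  assumes a: "a \<in> l1 G \<omega>" and h: "h \<in> l1 G \<omega>"
    and \<phi>: "\<And>u. u \<in> carrier G \<Longrightarrow> cmod (\<phi> u) \<le> B * \<omega> u"
  shows "(\<Sum>\<^sub>\<infinity>u\<in>carrier G. convolution G a h u * \<phi> u) =
         (\<Sum>\<^sub>\<infinity>v\<in>carrier G. a v * (\<Sum>\<^sub>\<infinity>w\<in>carrier G. h w * \<phi> (v \<otimes> w)))"
proof -
  have s: "(\<lambda>(v, u). a v * h (inv v \<otimes> u) * \<phi> u) summable_on carrier G \<times> carrier G"
  proof (rule abs_summable_summable, rule summable_on_comparison_test)
    show "(\<lambda>x. B * (case x of (v, u) \<Rightarrow> cmod (a v * h (inv v \<otimes> u)) * \<omega> u)) summable_on carrier G \<times> carrier G"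
      by (rule summable_on_cmult_right[OF convolution_pairs_summable[OF a h]])
    fix x assume "x \<in> carrier G \<times> carrier G"
    then show "norm (case x of (v, u) \<Rightarrow> a v * h (inv v \<otimes> u) * \<phi> u)
        \<le> B * (case x of (v, u) \<Rightarrow> cmod (a v * h (inv v \<otimes> u)) * \<omega> u)"
      using mult_left_mono[OF \<phi>[of "snd x"], of "cmod (a (fst x) * h (inv fst x \<otimes> snd x))"]
      by (auto simp: norm_mult ac_simps)
  qed simp
  have "(\<Sum>\<^sub>\<infinity>u\<in>carrier G. convolution G a h u * \<phi> u) =
        (\<Sum>\<^sub>\<infinity>u\<in>carrier G. \<Sum>\<^sub>\<infinity>v\<in>carrier G. a v * h (inv v \<otimes> u) * \<phi> u)"
    by (intro infsum_cong) (simp add: convolution_def infsum_cmult_left')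
  also have "\<dots> = (\<Sum>\<^sub>\<infinity>v\<in>carrier G. \<Sum>\<^sub>\<infinity>u\<in>carrier G. a v * h (inv v \<otimes> u) * \<phi> u)"
    by (rule infsum_swap_banach[OF s, symmetric])
  also have "\<dots> = (\<Sum>\<^sub>\<infinity>v\<in>carrier G. a v * (\<Sum>\<^sub>\<infinity>w\<in>carrier G. h w * \<phi> (v \<otimes> w)))"
  proof (rule infsum_cong)
    fix v assume v: "v \<in> carrier G"
    have "(\<Sum>\<^sub>\<infinity>u\<in>carrier G. a v * h (inv v \<otimes> u) * \<phi> u)
        = (\<Sum>\<^sub>\<infinity>w\<in>carrier G. a v * h (inv v \<otimes> (v \<otimes> w)) * \<phi> (v \<otimes> w))"
      by (rule infsum_reindex_bij_betw[OF bij_left_translate[OF v], symmetric])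
    also have "\<dots> = (\<Sum>\<^sub>\<infinity>w\<in>carrier G. a v * (h w * \<phi> (v \<otimes> w)))"
      by (rule infsum_cong) (use v in \<open>simp flip: m_assoc\<close>)
    finally show "(\<Sum>\<^sub>\<infinity>u\<in>carrier G. a v * h (inv v \<otimes> u) * \<phi> u)
        = a v * (\<Sum>\<^sub>\<infinity>w\<in>carrier G. h w * \<phi> (v \<otimes> w))"
      by (simp add: infsum_cmult_right')
  qed
  finally show ?thesis .
qed

lemma convolution_zero_left: "convolution G (\<lambda>u. 0) h = (\<lambda>u. 0)"
  by (simp add: convolution_def fun_eq_iff)

lemma convolution_one_left:
  assumes "h \<in> l1 G \<omega>"
  shows "convolution G (point \<one>) h = h"
proof
  fix u
  show "convolution G (point \<one>) h u = h u"
  proof (cases "u \<in> carrier G")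
    case True
    have "((\<lambda>v. point \<one> v * h (inv v \<otimes> u)) has_sum h u) (carrier G)"
      by (rule has_sum_finite_neutralI[of "{\<one>}"]) (use True in auto)
    then show ?thesis using True by (simp add: convolution_def infsumI)
  qed (use assms in \<open>simp add: convolution_def l1_outside\<close>)
qed

text \<open>
  Right multiplication by \<open>\<delta>\<^sub>e - \<delta>\<^sub>x\<close> is the divergence of a flow that sends \<open>a v\<close> from \<open>v\<close> to \<open>v \<otimes> x\<close>.
\<close>

lemma convolution_point_diff:
  assumes "u \<in> carrier G" "x \<in> carrier G"
  shows "convolution G a (\<lambda>u. point \<one> u - point x u) u = a u - a (u \<otimes> inv x)"
proof -
  have at: "((\<lambda>v. a v * point y (inv v \<otimes> u)) has_sum a (u \<otimes> inv y)) (carrier G)"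
    if y: "y \<in> carrier G" for y
  proof (rule has_sum_finite_neutralI[of "{u \<otimes> inv y}"])
    have eq: "inv (u \<otimes> inv y) \<otimes> u = y"
      using assms y by (simp add: inv_mult_group m_assoc)
    then show "a (u \<otimes> inv y) = (\<Sum>v\<in>{u \<otimes> inv y}. a v * point y (inv v \<otimes> u))"
      by simp
    fix v assume v: "v \<in> carrier G - {u \<otimes> inv y}"
    have "inv v \<otimes> u \<noteq> y"
    proof
      assume "inv v \<otimes> u = y"
      then have "v \<otimes> y = u" using v assms by (auto simp flip: m_assoc)
      then have "v = u \<otimes> inv y" using v y assms by (auto simp: m_assoc)
      then show False using v by simp
    qed
    then show "a v * point y (inv v \<otimes> u) = 0" by simp
  qed (use assms y in auto)
  have "((\<lambda>v. a v * point \<one> (inv v \<otimes> u) - a v * point x (inv v \<otimes> u))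
      has_sum (a (u \<otimes> inv \<one>) - a (u \<otimes> inv x))) (carrier G)"
    using has_sum_add[OF at[OF one_closed] has_sum_uminusI[OF at[OF assms(2)]]] by simp
  then show ?thesis
    using assms by (simp add: convolution_def infsumI right_diff_distrib)
qed

lemma abelian_group_l1_algebra: "abelian_group (l1_algebra G \<omega>)"
proof (rule abelian_groupI)
  fix f assume "f \<in> carrier (l1_algebra G \<omega>)"
  then show "\<exists>g\<in>carrier (l1_algebra G \<omega>). g \<oplus>\<^bsub>l1_algebra G \<omega>\<^esub> f = \<zero>\<^bsub>l1_algebra G \<omega>\<^esub>"
    by (intro bexI[of _ "\<lambda>u. - f u"]) (auto simp: l1_algebra_def l1_uminus)
qed (auto simp: l1_algebra_def l1_zero l1_add add.assoc add.commute)

lemma finsum_l1_algebra: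
  assumes "finite I" "\<And>i. i \<in> I \<Longrightarrow> f i \<in> l1 G \<omega>"
  shows "(\<Oplus>\<^bsub>l1_algebra G \<omega>\<^esub>i\<in>I. f i) = (\<lambda>u. \<Sum>i\<in>I. f i u)"
proof -
  interpret A: abelian_group "l1_algebra G \<omega>" by (rule abelian_group_l1_algebra)
  from assms show ?thesis
  proof (induction I rule: finite_induct)
    case empty
    show ?case by (simp only: A.finsum_empty) (simp add: l1_algebra_def)
  next
    case (insert i I)
    have "f \<in> I \<rightarrow> carrier (l1_algebra G \<omega>)" "f i \<in> carrier (l1_algebra G \<omega>)"
      using insert.prems by (auto simp: l1_algebra_def)
    then have "(\<Oplus>\<^bsub>l1_algebra G \<omega>\<^esub>i\<in>insert i I. f i)
        = f i \<oplus>\<^bsub>l1_algebra G \<omega>\<^esub> (\<Oplus>\<^bsub>l1_algebra G \<omega>\<^esub>i\<in>I. f i)"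
      by (rule A.finsum_insert[OF insert.hyps])
    then show ?case
      using insert by (simp add: l1_algebra_def)
  qed
qed

lemma augmentation_ideal_uminus:
  "f \<in> augmentation_ideal G \<omega> \<Longrightarrow> (\<lambda>u. - f u) \<in> augmentation_ideal G \<omega>"
  by (simp add: augmentation_ideal_def l1_uminus infsum_uminus)

lemma augmentation_ideal_add:
  assumes "f \<in> augmentation_ideal G \<omega>" "g \<in> augmentation_ideal G \<omega>"
  shows "(\<lambda>u. f u + g u) \<in> augmentation_ideal G \<omega>"
  using assms by (simp add: augmentation_ideal_def l1_add infsum_add l1_sum_summable)

lemma augmentation_ideal_sum:
  "(\<And>i. i \<in> I \<Longrightarrow> f i \<in> augmentation_ideal G \<omega>) \<Longrightarrow> (\<lambda>u. \<Sum>i\<in>I. f i u) \<in> augmentation_ideal G \<omega>"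
  by (induction I rule: infinite_finite_induct)
     (auto intro: augmentation_ideal_add, simp_all add: augmentation_ideal_def l1_zero)

lemma convolution_augmentation_ideal:
  assumes "a \<in> l1 G \<omega>" "h \<in> augmentation_ideal G \<omega>"
  shows "convolution G a h \<in> augmentation_ideal G \<omega>"
  using convolution_pairing[of a h "\<lambda>_. 1" 1] convolution_l1[of a h] assms weight_ge_1
  by (simp add: augmentation_ideal_def)

lemma left_ideal_augmentation_ideal: "left_ideal (augmentation_ideal G \<omega>) (l1_algebra G \<omega>)"
proof -
  interpret A: abelian_group "l1_algebra G \<omega>" by (rule abelian_group_l1_algebra)
  have neg: "inv\<^bsub>add_monoid (l1_algebra G \<omega>)\<^esub> f = (\<lambda>u. - f u)" if "f \<in> l1 G \<omega>" for f
    by (rule group.inv_equality[OF A.a_group]) (use that in \<open>auto simp: l1_algebra_def l1_uminus\<close>)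
  have sub: "f \<in> l1 G \<omega>" if "f \<in> augmentation_ideal G \<omega>" for f
    using that by (simp add: augmentation_ideal_def)
  have "subgroup (augmentation_ideal G \<omega>) (add_monoid (l1_algebra G \<omega>))"
  proof (rule group.subgroupI[OF A.a_group])
    show "augmentation_ideal G \<omega> \<subseteq> carrier (add_monoid (l1_algebra G \<omega>))"
      using sub by (auto simp: l1_algebra_def)
    show "augmentation_ideal G \<omega> \<noteq> {}"
      using l1_zero by (auto simp: augmentation_ideal_def)
    show "inv\<^bsub>add_monoid (l1_algebra G \<omega>)\<^esub> f \<in> augmentation_ideal G \<omega>"
      if "f \<in> augmentation_ideal G \<omega>" for f
      using that neg[OF sub[OF that]] augmentation_ideal_uminus by simp
    show "f \<otimes>\<^bsub>add_monoid (l1_algebra G \<omega>)\<^esub> g \<in> augmentation_ideal G \<omega>"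
      if "f \<in> augmentation_ideal G \<omega>" "g \<in> augmentation_ideal G \<omega>" for f g
      using augmentation_ideal_add[OF that] by (simp add: l1_algebra_def)
  qed
  then show ?thesis
    using convolution_augmentation_ideal
    by (auto simp: left_ideal_def additive_subgroup_def l1_algebra_def)
qed

lemma augmentation_ideal_finitely_generatedI:
  assumes "finite Y" "Y \<noteq> {}"
    and h: "\<And>y. y \<in> Y \<Longrightarrow> h y \<in> augmentation_ideal G \<omega>"
    and gen: "\<And>f. f \<in> augmentation_ideal G \<omega> \<Longrightarrow>
      \<exists>a. (\<forall>y\<in>Y. a y \<in> l1 G \<omega>) \<and> f = (\<lambda>u. \<Sum>y\<in>Y. convolution G (a y) (h y) u)"
  shows "finitely_generated_left_ideal (augmentation_ideal G \<omega>) (l1_algebra G \<omega>)"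
proof -
  obtain e where e: "bij_betw e {1..card Y} Y"
    using ex_bij_betw_nat_finite_1[OF assms(1)] by blast
  have eY: "e i \<in> Y" if "i \<in> {1..card Y}" for i
    using e that by (auto simp: bij_betw_def)
  have hl1: "h y \<in> l1 G \<omega>" if "y \<in> Y" for y
    using h[OF that] by (simp add: augmentation_ideal_def)
  have combination: "(\<Oplus>\<^bsub>l1_algebra G \<omega>\<^esub>i\<in>{1..card Y}. a i \<otimes>\<^bsub>l1_algebra G \<omega>\<^esub> h (e i))
      = (\<lambda>u. \<Sum>i\<in>{1..card Y}. convolution G (a i) (h (e i)) u)"
    if "\<And>i. i \<in> {1..card Y} \<Longrightarrow> a i \<in> l1 G \<omega>" for a
    using finsum_l1_algebra[of "{1..card Y}" "\<lambda>i. convolution G (a i) (h (e i))"]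
      convolution_l1 that hl1 eY by (simp add: l1_algebra_def)
  have "augmentation_ideal G \<omega> = {(\<Oplus>\<^bsub>l1_algebra G \<omega>\<^esub>i\<in>{1..card Y}. a i \<otimes>\<^bsub>l1_algebra G \<omega>\<^esub> h (e i)) | a.
      a \<in> {1..card Y} \<rightarrow> carrier (l1_algebra G \<omega>)}" (is "_ = ?R")
  proof
    show "?R \<subseteq> augmentation_ideal G \<omega>"
    proof
      fix f assume "f \<in> ?R"
      then obtain a where f: "f = (\<Oplus>\<^bsub>l1_algebra G \<omega>\<^esub>i\<in>{1..card Y}. a i \<otimes>\<^bsub>l1_algebra G \<omega>\<^esub> h (e i))"
        and aA: "a \<in> {1..card Y} \<rightarrow> carrier (l1_algebra G \<omega>)"
        by blast
      have a: "a i \<in> l1 G \<omega>" if "i \<in> {1..card Y}" for i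
        using funcset_mem[OF aA that] by (simp add: l1_algebra_def)
      have f': "f = (\<lambda>u. \<Sum>i\<in>{1..card Y}. convolution G (a i) (h (e i)) u)"
        unfolding f by (rule combination) (rule a)
      show "f \<in> augmentation_ideal G \<omega>"
        unfolding f' by (intro augmentation_ideal_sum convolution_augmentation_ideal a h eY)
    qed
    show "augmentation_ideal G \<omega> \<subseteq> ?R"
    proof
      fix f assume "f \<in> augmentation_ideal G \<omega>"
      then obtain a where a: "\<And>y. y \<in> Y \<Longrightarrow> a y \<in> l1 G \<omega>"
        and f: "f = (\<lambda>u. \<Sum>y\<in>Y. convolution G (a y) (h y) u)"
        using gen by blast
      have "f = (\<lambda>u. \<Sum>i\<in>{1..card Y}. convolution G (a (e i)) (h (e i)) u)"
        unfolding f by (rule ext, rule sum.reindex_bij_betw[OF e, symmetric])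
      then have "f = (\<Oplus>\<^bsub>l1_algebra G \<omega>\<^esub>i\<in>{1..card Y}. (a \<circ> e) i \<otimes>\<^bsub>l1_algebra G \<omega>\<^esub> h (e i))"
        using combination[of "a \<circ> e"] a eY by simp
      moreover have "a \<circ> e \<in> {1..card Y} \<rightarrow> carrier (l1_algebra G \<omega>)"
        using a eY by (auto simp: l1_algebra_def)
      ultimately show "f \<in> ?R" by blast
    qed
  qed
  moreover have "h \<circ> e \<in> {1..card Y} \<rightarrow> carrier (l1_algebra G \<omega>)"
    using hl1 eY by (auto simp: l1_algebra_def)
  moreover have "1 \<le> card Y"
    using assms by (simp add: Suc_leI card_gt_0_iff)
  ultimately show ?thesis
    unfolding finitely_generated_left_ideal_def
    using left_ideal_augmentation_ideal by (intro conjI exI[of _ "card Y"] bexI[of _ "h \<circ> e"]) simp_all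
qed

text \<open>
  That the generators lie in the ideal itself follows by letting one coefficient be the unit and all
  others be zero.
\<close>

lemma augmentation_ideal_finitely_generatedE:
  assumes "finitely_generated_left_ideal (augmentation_ideal G \<omega>) (l1_algebra G \<omega>)"
  obtains n :: nat and h where "\<And>i. i \<in> {1..n} \<Longrightarrow> h i \<in> augmentation_ideal G \<omega>"
    and "\<And>f. f \<in> augmentation_ideal G \<omega> \<Longrightarrow>
      \<exists>a. (\<forall>i\<in>{1..n}. a i \<in> l1 G \<omega>) \<and> f = (\<lambda>u. \<Sum>i\<in>{1..n}. convolution G (a i) (h i) u)"
proof -
  obtain n h where h: "h \<in> {1..n::nat} \<rightarrow> carrier (l1_algebra G \<omega>)"
    and gen: "augmentation_ideal G \<omega> = {(\<Oplus>\<^bsub>l1_algebra G \<omega>\<^esub>i\<in>{1..n}. a i \<otimes>\<^bsub>l1_algebra G \<omega>\<^esub> h i) | a.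
      a \<in> {1..n} \<rightarrow> carrier (l1_algebra G \<omega>)}"
    using assms unfolding finitely_generated_left_ideal_def by blast
  have hl1: "h i \<in> l1 G \<omega>" if "i \<in> {1..n}" for i
    using h that by (auto simp: l1_algebra_def)
  have combination: "(\<Oplus>\<^bsub>l1_algebra G \<omega>\<^esub>i\<in>{1..n}. a i \<otimes>\<^bsub>l1_algebra G \<omega>\<^esub> h i)
      = (\<lambda>u. \<Sum>i\<in>{1..n}. convolution G (a i) (h i) u)"
    if "\<And>i. i \<in> {1..n} \<Longrightarrow> a i \<in> l1 G \<omega>" for a
    using finsum_l1_algebra[of "{1..n}" "\<lambda>i. convolution G (a i) (h i)"]
      convolution_l1 that hl1 by (simp add: l1_algebra_def)
  have rep: "\<exists>a. (\<forall>i\<in>{1..n}. a i \<in> l1 G \<omega>) \<and> f = (\<lambda>u. \<Sum>i\<in>{1..n}. convolution G (a i) (h i) u)"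
    if f: "f \<in> augmentation_ideal G \<omega>" for f
  proof -
    obtain a where fa: "f = (\<Oplus>\<^bsub>l1_algebra G \<omega>\<^esub>i\<in>{1..n}. a i \<otimes>\<^bsub>l1_algebra G \<omega>\<^esub> h i)"
      and aA: "a \<in> {1..n} \<rightarrow> carrier (l1_algebra G \<omega>)"
      using f unfolding gen by blast
    have a: "a i \<in> l1 G \<omega>" if "i \<in> {1..n}" for i
      using funcset_mem[OF aA that] by (simp add: l1_algebra_def)
    have "f = (\<lambda>u. \<Sum>i\<in>{1..n}. convolution G (a i) (h i) u)"
      unfolding fa by (rule combination) (rule a)
    then show ?thesis using a by blast
  qed
  have "h j \<in> augmentation_ideal G \<omega>" if j: "j \<in> {1..n}" for j
  proof -
    define a where "a i = (if i = j then point \<one> else (\<lambda>u. 0))" for i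
    have a: "a i \<in> l1 G \<omega>" for i
      using l1_point[of \<one>] l1_zero by (simp add: a_def)
    have "h j u = (\<Sum>i\<in>{1..n}. convolution G (a i) (h i) u)" for u
    proof -
      have "convolution G (a i) (h i) u = (if i = j then h j u else 0)" if "i \<in> {1..n}" for i
        using convolution_one_left[OF hl1[OF j]] by (simp add: a_def convolution_zero_left)
      then show ?thesis using j by simp
    qed
    then have "h j = (\<Oplus>\<^bsub>l1_algebra G \<omega>\<^esub>i\<in>{1..n}. a i \<otimes>\<^bsub>l1_algebra G \<omega>\<^esub> h i)"
      using combination[of a, OF a] by (simp add: fun_eq_iff)
    moreover have "a \<in> {1..n} \<rightarrow> carrier (l1_algebra G \<omega>)"
      using a by (simp add: l1_algebra_def)
    ultimately show ?thesis unfolding gen by blast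
  qed
  then show ?thesis using that rep by blast
qed

end

section \<open>Radial weights: geodesic flows give generators\<close>

locale radially_weighted_group = finitely_generated_group G X + weighted_group G \<omega>
  for G (structure) and X and \<omega> +
  fixes \<tau> :: "nat \<Rightarrow> real"
  assumes infinite_group: "infinite (carrier G)"
    and weight_on_sphere: "\<And>n u. n \<ge> 1 \<Longrightarrow> u \<in> word_sphere G X n \<Longrightarrow> \<omega> u = \<tau> n"
begin

lemma weight_eq_len: "u \<in> carrier G \<Longrightarrow> len u \<ge> 1 \<Longrightarrow> \<omega> u = \<tau> (len u)"
  using weight_on_sphere by (auto simp: word_sphere_def)

lemma sphere_weight_ge_1: "n \<ge> 1 \<Longrightarrow> 1 \<le> \<tau> n"
  using word_sphere_nonempty[OF infinite_group, of n] weight_eq_len weight_ge_1 by metis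

text \<open>
  The choice of one descending letter at each element fixes a geodesic spanning tree of the Cayley
  graph, rooted at the identity.
\<close>

definition descending_letter :: "'a \<Rightarrow> 'a" where
  "descending_letter u = (SOME x. x \<in> X \<and> Suc (len (u \<otimes> x)) = len u)"

definition parent :: "'a \<Rightarrow> 'a" where
  "parent u = u \<otimes> descending_letter u"

lemma descending_letter:
  assumes "u \<in> carrier G" "u \<noteq> \<one>"
  shows "descending_letter u \<in> X" and "Suc (len (parent u)) = len u"
    and "parent u \<in> carrier G"
proof -
  have "\<exists>x. x \<in> X \<and> Suc (len (u \<otimes> x)) = len u"
    using ex_descending_letter[OF assms] by blast
  then show "descending_letter u \<in> X" "Suc (len (parent u)) = len u"
    unfolding descending_letter_def parent_def by (rule someI2_ex, simp)+
  then show "parent u \<in> carrier G"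
    using assms by (simp add: parent_def)
qed

lemma iterated_parent:
  assumes "g \<in> carrier G" "k \<le> len g"
  shows "(parent ^^ k) g \<in> carrier G \<and> len ((parent ^^ k) g) = len g - k"
  using assms(2)
proof (induction k)
  case 0
  then show ?case using assms by simp
next
  case (Suc k)
  let ?u = "(parent ^^ k) g"
  have u: "?u \<in> carrier G" "len ?u = len g - k" using Suc by auto
  have "?u \<noteq> \<one>" using u Suc.prems by auto
  then show ?case
    using descending_letter(2,3)[OF u(1)] u Suc.prems by simp
qed

lemma iterated_parent_ne_one:
  assumes "g \<in> carrier G" "k < len g"
  shows "(parent ^^ k) g \<noteq> \<one>"
  using iterated_parent[of g k] assms by auto

text \<open>
  The indicator function of the path from \<open>g\<close>, with the identity left out. Writing it as a number of
  visits makes the divergence of the path a telescoping sum.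
\<close>

definition visits :: "'a \<Rightarrow> 'a \<Rightarrow> real" where
  "visits u g = (\<Sum>k<len g. of_bool ((parent ^^ k) g = u))"

lemma visits_nonneg: "0 \<le> visits u g"
  unfolding visits_def by (intro sum_nonneg) simp

lemma visits_one: "g \<in> carrier G \<Longrightarrow> visits \<one> g = 0"
  unfolding visits_def using iterated_parent_ne_one by simp

lemma visits_outside: "g \<in> carrier G \<Longrightarrow> u \<notin> carrier G \<Longrightarrow> visits u g = 0"
  unfolding visits_def using iterated_parent[of g] by (auto intro!: sum.neutral)

text \<open>
  Conservation of mass: a path that enters \<open>u\<close> from a child leaves it again, except at the start \<open>g\<close>
  and at the identity. The elements \<open>u \<otimes> inv x\<close> whose descending letter is \<open>x\<close> are the children of \<open>u\<close>,
  and every step from \<open>c\<close> to \<open>parent c = u\<close> comes from exactly one such \<open>x\<close>.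
\<close>

lemma visits_children:
  assumes g: "g \<in> carrier G" and u: "u \<in> carrier G"
  shows "visits u g - (\<Sum>x\<in>X. of_bool (descending_letter (u \<otimes> inv x) = x) * visits (u \<otimes> inv x) g)
       = of_bool (g = u) - of_bool (u = \<one>)"
proof -
  have child: "(\<Sum>x\<in>X. of_bool (descending_letter (u \<otimes> inv x) = x) * of_bool (c = u \<otimes> inv x) :: real)
      = of_bool (parent c = u)" if c: "c \<in> carrier G" "c \<noteq> \<one>" for c
  proof -
    have x: "descending_letter c \<in> X" using descending_letter c by blast
    have iff: "descending_letter (u \<otimes> inv x) = x \<and> c = u \<otimes> inv x \<longleftrightarrow> x = descending_letter c \<and> parent c = u"
      if "x \<in> X" for x
    proof -
      have "c = u \<otimes> inv x \<longleftrightarrow> c \<otimes> x = u"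
        using inv_solve_right[of c u x] c u that by auto
      then show ?thesis by (auto simp: parent_def)
    qed
    have "(\<Sum>x\<in>X. of_bool (descending_letter (u \<otimes> inv x) = x) * of_bool (c = u \<otimes> inv x) :: real)
        = (\<Sum>x\<in>X. if x = descending_letter c then of_bool (parent c = u) else 0)"
    proof (rule sum.cong[OF refl])
      fix x assume "x \<in> X"
      have "of_bool (descending_letter (u \<otimes> inv x) = x) * of_bool (c = u \<otimes> inv x)
          = (of_bool (x = descending_letter c \<and> parent c = u) :: real)"
        unfolding of_bool_conj[symmetric] iff[OF \<open>x \<in> X\<close>] ..
      then show "of_bool (descending_letter (u \<otimes> inv x) = x) * of_bool (c = u \<otimes> inv x)
          = (if x = descending_letter c then of_bool (parent c = u) else 0 :: real)"
        by simp
    qed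
    also have "\<dots> = of_bool (parent c = u)"
      using x finite_letters by simp
    finally show ?thesis .
  qed
  have "(\<Sum>x\<in>X. of_bool (descending_letter (u \<otimes> inv x) = x) * visits (u \<otimes> inv x) g)
      = (\<Sum>k<len g. \<Sum>x\<in>X. of_bool (descending_letter (u \<otimes> inv x) = x) * of_bool ((parent ^^ k) g = u \<otimes> inv x))"
    unfolding visits_def sum_distrib_left by (rule sum.swap)
  also have "\<dots> = (\<Sum>k<len g. of_bool ((parent ^^ Suc k) g = u))"
    by (rule sum.cong) (use child iterated_parent[OF g] iterated_parent_ne_one[OF g] in auto)
  finally have "visits u g - (\<Sum>x\<in>X. of_bool (descending_letter (u \<otimes> inv x) = x) * visits (u \<otimes> inv x) g)
      = (\<Sum>k<len g. of_bool ((parent ^^ k) g = u) - of_bool ((parent ^^ Suc k) g = u))"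
    by (simp add: visits_def sum_subtractf)
  also have "\<dots> = of_bool (g = u) - of_bool ((parent ^^ len g) g = u)"
    using sum_lessThan_telescope'[of "\<lambda>k. of_bool ((parent ^^ k) g = u) :: real" "len g"] by simp
  also have "(parent ^^ len g) g = \<one>"
    using iterated_parent[OF g, of "len g"] len_eq_0_iff by auto
  finally show ?thesis by (simp add: eq_commute)
qed

lemma path_weight:
  assumes "g \<in> carrier G"
  shows "(\<Sum>k<len g. \<omega> ((parent ^^ k) g)) = (\<Sum>n\<in>{1..len g}. \<tau> n)"
proof -
  have "(\<Sum>k<len g. \<omega> ((parent ^^ k) g)) = (\<Sum>k<len g. \<tau> (len g - k))"
    using iterated_parent[OF assms] weight_eq_len by (intro sum.cong) auto
  also have "\<dots> = (\<Sum>n\<in>{1..len g}. \<tau> n)"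
    by (rule sum.reindex_bij_witness[of _ "\<lambda>n. len g - n" "\<lambda>k. len g - k"]) auto
  finally show ?thesis .
qed

text \<open>
  The end point \<open>g\<close> of the path adds \<open>\<tau> (len g)\<close> to the lower sum; this is the summand \<open>1\<close> in the
  constant. The absolute value only makes the constant nonnegative.
\<close>

lemma path_weight_le:
  assumes C: "\<And>m. m \<ge> 1 \<Longrightarrow> lower_sum \<tau> m \<le> C * \<tau> m" and g: "g \<in> carrier G"
  shows "(\<Sum>k<len g. \<omega> ((parent ^^ k) g)) \<le> (\<bar>C\<bar> + 1) * \<omega> g"
proof (cases "len g")
  case 0
  then show ?thesis using weight_nonneg[OF g] by simp
next
  case (Suc m)
  then have "(\<Sum>k<len g. \<omega> ((parent ^^ k) g)) = lower_sum \<tau> (len g) + \<tau> (len g)"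
    unfolding path_weight[OF g] lower_sum_def
    by (simp add: atLeastLessThanSuc_atLeastAtMost)
  also have "\<dots> \<le> C * \<omega> g + \<omega> g"
    using C[of "len g"] Suc weight_eq_len[OF g] by simp
  also have "\<dots> \<le> (\<bar>C\<bar> + 1) * \<omega> g"
    using weight_nonneg[OF g] by (simp add: distrib_right mult_right_mono)
  finally show ?thesis .
qed

text \<open>
  The total mass in the subtree below \<open>u\<close>, which is what the flow carries from \<open>u\<close> to its parent.
\<close>

definition subtree_sum :: "('a \<Rightarrow> complex) \<Rightarrow> 'a \<Rightarrow> complex" where
  "subtree_sum f u = (\<Sum>\<^sub>\<infinity>g\<in>carrier G. f g * complex_of_real (visits u g))"

lemma visits_le:
  assumes C: "\<And>m. m \<ge> 1 \<Longrightarrow> lower_sum \<tau> m \<le> C * \<tau> m" and g: "g \<in> carrier G"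
  shows "visits u g \<le> (\<bar>C\<bar> + 1) * \<omega> g"
proof -
  have "visits u g \<le> (\<Sum>k<len g. \<omega> ((parent ^^ k) g))"
    unfolding visits_def
  proof (rule sum_mono)
    fix k assume "k \<in> {..<len g}"
    then have "1 \<le> \<omega> ((parent ^^ k) g)" using iterated_parent[OF g, of k] weight_ge_1 by simp
    then show "of_bool ((parent ^^ k) g = u) \<le> \<omega> ((parent ^^ k) g)"
      by (cases "(parent ^^ k) g = u") auto
  qed
  also have "\<dots> \<le> (\<bar>C\<bar> + 1) * \<omega> g" by (rule path_weight_le[OF C g])
  finally show ?thesis .
qed

text \<open>
  Summing over the tree first, the mass at \<open>g\<close> is charged with the weight of its path to the identity.
\<close>

lemma subtree_sum_l1:
  assumes C: "\<And>m. m \<ge> 1 \<Longrightarrow> lower_sum \<tau> m \<le> C * \<tau> m" and f: "f \<in> l1 G \<omega>"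
  shows "subtree_sum f \<in> l1 G \<omega>"
proof (rule l1I)
  define q where "q g = cmod (f g) * (\<Sum>k<len g. \<omega> ((parent ^^ k) g))" for g
  let ?p = "\<lambda>(g, u). cmod (f g) * visits u g * \<omega> u"
  have "?p summable_on carrier G \<times> carrier G"
  proof (rule summable_on_SigmaI)
    fix g assume g: "g \<in> carrier G"
    have "((\<lambda>u. of_bool ((parent ^^ k) g = u) * \<omega> u) has_sum \<omega> ((parent ^^ k) g)) (carrier G)"
      if "k \<in> {..<len g}" for k
      by (rule has_sum_finite_neutralI[of "{(parent ^^ k) g}"])
         (use that iterated_parent[OF g, of k] in auto)
    then have "((\<lambda>u. \<Sum>k<len g. of_bool ((parent ^^ k) g = u) * \<omega> u)
        has_sum (\<Sum>k<len g. \<omega> ((parent ^^ k) g))) (carrier G)"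
      by (intro has_sum_finite_sum) auto
    then show "((\<lambda>u. ?p (g, u)) has_sum q g) (carrier G)"
      unfolding q_def visits_def prod.case sum_distrib_right[symmetric] mult.assoc
      by (rule has_sum_cmult_right)
  next
    show "q summable_on carrier G"
    proof (rule summable_on_comparison_test)
      show "(\<lambda>g. (\<bar>C\<bar> + 1) * (cmod (f g) * \<omega> g)) summable_on carrier G"
        by (intro summable_on_cmult_right l1_summable f)
      fix g assume g: "g \<in> carrier G"
      show "q g \<le> (\<bar>C\<bar> + 1) * (cmod (f g) * \<omega> g)"
        using mult_left_mono[OF path_weight_le[OF C g], of "cmod (f g)"] by (simp add: q_def ac_simps)
      have "0 \<le> \<omega> ((parent ^^ k) g)" if "k < len g" for k
        using iterated_parent[OF g, of k] weight_nonneg that by simp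
      then show "0 \<le> q g"
        unfolding q_def by (intro mult_nonneg_nonneg sum_nonneg) auto
    qed
  qed (auto simp: visits_nonneg weight_nonneg)
  then have "(\<lambda>(u, g). cmod (f g) * visits u g * \<omega> u) summable_on carrier G \<times> carrier G"
    by (subst (asm) summable_on_swap) simp
  then show "(\<lambda>u. \<Sum>\<^sub>\<infinity>g\<in>carrier G. cmod (f g) * visits u g * \<omega> u) summable_on carrier G"
    by (rule summable_on_Sigma_banach)
  fix u assume u: "u \<in> carrier G"
  have "(\<lambda>g. f g * complex_of_real (visits u g)) abs_summable_on carrier G"
    using visits_le[OF C] visits_nonneg
    by (intro l1_times_dominated_summable[OF f, of _ "\<bar>C\<bar> + 1"]) auto
  then have "cmod (subtree_sum f u) \<le> (\<Sum>\<^sub>\<infinity>g\<in>carrier G. cmod (f g * complex_of_real (visits u g)))"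
    unfolding subtree_sum_def by (rule norm_infsum_bound)
  then show "cmod (subtree_sum f u) * \<omega> u \<le> (\<Sum>\<^sub>\<infinity>g\<in>carrier G. cmod (f g) * visits u g * \<omega> u)"
    using mult_right_mono[OF _ weight_nonneg[OF u]]
    by (simp add: infsum_cmult_left' norm_mult visits_nonneg)
qed (auto simp: subtree_sum_def visits_outside intro!: infsum_0)

definition flow :: "('a \<Rightarrow> complex) \<Rightarrow> 'a \<Rightarrow> 'a \<Rightarrow> complex" where
  "flow f x u = (if descending_letter u = x then subtree_sum f u else 0)"

lemma flow_l1:
  assumes "\<And>m. m \<ge> 1 \<Longrightarrow> lower_sum \<tau> m \<le> C * \<tau> m" and "f \<in> l1 G \<omega>"
  shows "flow f x \<in> l1 G \<omega>"
proof (rule l1I)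
  have F: "subtree_sum f \<in> l1 G \<omega>" by (rule subtree_sum_l1[OF assms])
  then show "(\<lambda>u. cmod (subtree_sum f u) * \<omega> u) summable_on carrier G" by (rule l1_summable)
  show "flow f x u = 0" if "u \<notin> carrier G" for u
    using that l1_outside[OF F] by (simp add: flow_def)
qed (simp add: flow_def weight_nonneg)

text \<open>
  The divergence of the flow at \<open>u\<close> is the subtree sum at \<open>u\<close> minus the subtree sums at its children.
  By \<open>visits_children\<close> this equals \<open>f u\<close>, except for the term \<open>- (\<Sum>\<^sub>\<infinity>g. f g)\<close> at the identity, which is
  zero in the augmentation ideal.
\<close>

lemma flow_decomposition:
  assumes C: "\<And>m. m \<ge> 1 \<Longrightarrow> lower_sum \<tau> m \<le> C * \<tau> m" and f: "f \<in> augmentation_ideal G \<omega>"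
  shows "f = (\<lambda>u. \<Sum>x\<in>X. convolution G (flow f x) (\<lambda>v. point \<one> v - point x v) u)"
proof -
  have fl1: "f \<in> l1 G \<omega>" and f0: "(\<Sum>\<^sub>\<infinity>u\<in>carrier G. f u) = 0"
    using f by (auto simp: augmentation_ideal_def)
  have summ: "(\<lambda>g. f g * complex_of_real (visits u g)) summable_on carrier G" for u
    by (rule abs_summable_summable, rule l1_times_dominated_summable[OF fl1, of _ "\<bar>C\<bar> + 1"])
       (use visits_le[OF C] visits_nonneg in auto)
  show "f = (\<lambda>u. \<Sum>x\<in>X. convolution G (flow f x) (\<lambda>v. point \<one> v - point x v) u)"
  proof
    fix u
    show "f u = (\<Sum>x\<in>X. convolution G (flow f x) (\<lambda>v. point \<one> v - point x v) u)"
    proof (cases "u \<in> carrier G")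
      case False
      then show ?thesis using l1_outside[OF fl1] by (simp add: convolution_def)
    next
      case u: True
      let ?d = "\<lambda>x. of_bool (descending_letter (u \<otimes> inv x) = x) :: real"
      \<comment> \<open>The identity has a descending letter only by default, but nothing is carried away from it.\<close>
      have own: "(\<Sum>x\<in>X. flow f x u) = subtree_sum f u"
      proof (cases "u = \<one>")
        case True
        have "subtree_sum f \<one> = 0"
          unfolding subtree_sum_def using visits_one by (intro infsum_0) simp
        then show ?thesis using True by (auto simp: flow_def intro!: sum.neutral)
      next
        case False
        then show ?thesis
          using descending_letter(1)[OF u] finite_letters by (simp add: flow_def)
      qed
      have "((\<lambda>g. \<Sum>x\<in>X. of_real (?d x) * (f g * complex_of_real (visits (u \<otimes> inv x) g)))
          has_sum (\<Sum>x\<in>X. of_real (?d x) * subtree_sum f (u \<otimes> inv x))) (carrier G)"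
        unfolding subtree_sum_def
        by (rule has_sum_finite_sum[OF finite_letters], rule has_sum_cmult_right, rule has_sum_infsum, rule summ)
      moreover have "((\<lambda>g. f g * complex_of_real (visits u g)) has_sum subtree_sum f u) (carrier G)"
        unfolding subtree_sum_def by (intro has_sum_infsum summ)
      ultimately have "((\<lambda>g. f g * complex_of_real (visits u g)
            + - (\<Sum>x\<in>X. of_real (?d x) * (f g * complex_of_real (visits (u \<otimes> inv x) g))))
          has_sum subtree_sum f u + - (\<Sum>x\<in>X. of_real (?d x) * subtree_sum f (u \<otimes> inv x))) (carrier G)"
        by (intro has_sum_add has_sum_uminusI)
      moreover have "f g * complex_of_real (visits u g)
            + - (\<Sum>x\<in>X. of_real (?d x) * (f g * complex_of_real (visits (u \<otimes> inv x) g)))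
          = f u * point u g + - of_bool (u = \<one>) * f g" if g: "g \<in> carrier G" for g
      proof -
        have "f g * complex_of_real (visits u g)
            + - (\<Sum>x\<in>X. of_real (?d x) * (f g * complex_of_real (visits (u \<otimes> inv x) g)))
          = f g * complex_of_real (visits u g - (\<Sum>x\<in>X. ?d x * visits (u \<otimes> inv x) g))"
          by (simp add: right_diff_distrib sum_distrib_left ac_simps)
        also have "\<dots> = f u * point u g + - of_bool (u = \<one>) * f g"
          unfolding visits_children[OF g u] by (auto simp: right_diff_distrib)
        finally show ?thesis .
      qed
      ultimately have "((\<lambda>g. f u * point u g + - of_bool (u = \<one>) * f g)
          has_sum subtree_sum f u + - (\<Sum>x\<in>X. of_real (?d x) * subtree_sum f (u \<otimes> inv x))) (carrier G)"
        by (subst (asm) has_sum_cong) auto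
      moreover have "((\<lambda>g. f u * point u g + - of_bool (u = \<one>) * f g) has_sum f u + - of_bool (u = \<one>) * 0) (carrier G)"
        using has_sum_infsum[OF l1_sum_summable[OF fl1]] f0
        by (intro has_sum_add has_sum_point[OF u] has_sum_cmult_right) simp
      ultimately have "f u = subtree_sum f u - (\<Sum>x\<in>X. of_real (?d x) * subtree_sum f (u \<otimes> inv x))"
        using has_sum_unique by fastforce
      also have "(\<Sum>x\<in>X. of_real (?d x) * subtree_sum f (u \<otimes> inv x)) = (\<Sum>x\<in>X. flow f x (u \<otimes> inv x))"
        by (intro sum.cong) (auto simp: flow_def)
      also have "subtree_sum f u - \<dots> = (\<Sum>x\<in>X. convolution G (flow f x) (\<lambda>v. point \<one> v - point x v) u)"
        unfolding own[symmetric] sum_subtractf[symmetric]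
        using convolution_point_diff[OF u] by (intro sum.cong) auto
      finally show ?thesis .
    qed
  qed
qed

lemma lower_sum_bound_imp_finitely_generated:
  assumes C: "\<And>m. m \<ge> 1 \<Longrightarrow> lower_sum \<tau> m \<le> C * \<tau> m"
  shows "finitely_generated_left_ideal (augmentation_ideal G \<omega>) (l1_algebra G \<omega>)"
proof (rule augmentation_ideal_finitely_generatedI[OF finite_letters])
  show "X \<noteq> {}"
  proof -
    obtain u where "u \<in> carrier G" "len u = 1"
      using word_sphere_nonempty[OF infinite_group] by blast
    moreover from this have "u \<noteq> \<one>" by auto
    ultimately show ?thesis using ex_descending_letter[of u] by blast
  qed
  fix x assume x: "x \<in> X"
  have s: "((\<lambda>u. 1 * point \<one> u + - (1 * point x u)) has_sum 1 + - 1) (carrier G)"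
    using x by (intro has_sum_add has_sum_uminusI has_sum_point) auto
  have "(\<Sum>\<^sub>\<infinity>u\<in>carrier G. point \<one> u - point x u) = 0"
    using infsumI[OF s] by (simp only: mult_1_left add_uminus_conv_diff diff_self)
  then show "(\<lambda>u. point \<one> u - point x u) \<in> augmentation_ideal G \<omega>"
    using x l1_diff[OF l1_point l1_point, of \<one> x] by (simp add: augmentation_ideal_def)
next
  fix f assume f: "f \<in> augmentation_ideal G \<omega>"
  show "\<exists>a. (\<forall>x\<in>X. a x \<in> l1 G \<omega>) \<and> f = (\<lambda>u. \<Sum>x\<in>X. convolution G (a x) (\<lambda>v. point \<one> v - point x v) u)"
  proof (intro exI conjI ballI)
    show "flow f x \<in> l1 G \<omega>" for x
      by (rule flow_l1[OF C]) (use f in \<open>auto simp: augmentation_ideal_def\<close>)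
    show "f = (\<lambda>u. \<Sum>x\<in>X. convolution G (flow f x) (\<lambda>v. point \<one> v - point x v) u)"
      by (rule flow_decomposition[OF C f])
  qed
qed

section \<open>Radial weights: generators bound the lower sums\<close>

text \<open>
  The functional dual to the flows above: the weight of the levels strictly between the identity
  and \<open>u\<close>.
\<close>

definition height :: "'a \<Rightarrow> real" where
  "height u = lower_sum \<tau> (len u)"

lemma height_nonneg: "0 \<le> height u"
  unfolding height_def using sphere_weight_ge_1 by (intro lower_sum_nonneg) (auto intro: order_trans[OF zero_le_one])

lemma height_one [simp]: "height \<one> = 0"
  by (simp add: height_def lower_sum_def)

lemma height_mult_letter:
  assumes v: "v \<in> carrier G" and x: "x \<in> X"
  shows "\<bar>height (v \<otimes> x) - height v\<bar> \<le> \<omega> v * \<omega> x"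
proof -
  have vx: "v \<otimes> x \<in> carrier G" using v x by simp
  have pos: "0 \<le> \<omega> v * \<omega> x"
    using weight_nonneg v x by simp
  have up: "height b - height a = (if len a = 0 then 0 else \<omega> a)"
    if "len b = Suc (len a)" "a \<in> carrier G" for a b
    using that weight_eq_len[of a] by (auto simp: height_def lower_sum_Suc)
  consider "len (v \<otimes> x) = len v" | "len (v \<otimes> x) = Suc (len v)" | "len v = Suc (len (v \<otimes> x))"
    using len_mult_letter_le[OF v x] len_le_mult_letter[OF v x] by linarith
  then show ?thesis
  proof cases
    case 1
    then show ?thesis using pos by (simp add: height_def)
  next
    case 2
    have "\<omega> v * 1 \<le> \<omega> v * \<omega> x"
      using weight_ge_1 weight_nonneg v x by (intro mult_left_mono) auto
    then show ?thesis using up[OF 2 v] pos weight_nonneg[OF v] by auto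
  next
    case 3
    then show ?thesis
      using up[OF 3 vx] pos weight_nonneg[OF vx] weight_mult[of v x] v x
      by (auto simp: abs_minus_commute)
  qed
qed

text \<open>
  Telescoping along a word for \<open>w\<close>; the constant depends on \<open>w\<close> alone.
\<close>

lemma height_mult:
  assumes "w \<in> carrier G"
  shows "\<exists>C\<ge>0. \<forall>v\<in>carrier G. \<bar>height (v \<otimes> w) - height v\<bar> \<le> C * \<omega> v"
proof -
  obtain ws where "set ws \<subseteq> X" and w: "word_value ws = w"
    using ex_word[OF assms] by blast
  then have "\<exists>C\<ge>0. \<forall>v\<in>carrier G. \<bar>height (v \<otimes> word_value ws) - height v\<bar> \<le> C * \<omega> v"
  proof (induction ws arbitrary: w rule: rev_induct)
    case Nil
    show ?case by (rule exI[of _ 0]) simp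
  next
    case (snoc x ws)
    let ?w = "word_value ws"
    have x: "x \<in> X" and ws: "set ws \<subseteq> X" using snoc.prems by auto
    obtain C where C: "0 \<le> C" "\<And>v. v \<in> carrier G \<Longrightarrow> \<bar>height (v \<otimes> ?w) - height v\<bar> \<le> C * \<omega> v"
      using snoc.IH[OF ws refl] by blast
    have "\<bar>height (v \<otimes> word_value (ws @ [x])) - height v\<bar> \<le> (C + \<omega> ?w * \<omega> x) * \<omega> v"
      if v: "v \<in> carrier G" for v
    proof -
      have eq: "v \<otimes> word_value (ws @ [x]) = (v \<otimes> ?w) \<otimes> x"
        using word_value_append[OF ws, of "[x]"] x ws v by (simp add: m_assoc)
      have "\<bar>height ((v \<otimes> ?w) \<otimes> x) - height (v \<otimes> ?w)\<bar> \<le> \<omega> (v \<otimes> ?w) * \<omega> x"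
        using height_mult_letter v ws x by simp
      moreover have "\<omega> (v \<otimes> ?w) * \<omega> x \<le> (\<omega> v * \<omega> ?w) * \<omega> x"
        using weight_mult weight_nonneg v ws x by (intro mult_right_mono) auto
      moreover have "(\<omega> v * \<omega> ?w) * \<omega> x = \<omega> ?w * \<omega> x * \<omega> v"
        by simp
      ultimately show ?thesis
        using C(2)[OF v] unfolding eq distrib_right by linarith
    qed
    moreover have "0 \<le> C + \<omega> ?w * \<omega> x"
      using C(1) weight_nonneg ws x by simp
    ultimately show ?case by blast
  qed
  then show ?thesis using w by simp
qed

text \<open>
  Since \<open>h\<close> has total mass zero, only differences \<open>\<sigma> (v \<otimes> w) - \<sigma> v\<close> of the truncated height matter. On a
  finite set of elements \<open>w\<close> that carries most of the norm of \<open>h\<close>, they are bounded by a multiple of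
  \<open>\<omega> v\<close> that depends neither on the truncation nor on \<open>D\<close>; elsewhere the trivial bound by
  \<open>D * \<omega> v * \<omega> w\<close> costs only \<open>\<epsilon> * D * \<omega> v\<close>. The order of the quantifiers, with \<open>C\<close> chosen before \<open>L\<close> and
  \<open>D\<close>, is what the converse direction relies on.
\<close>

lemma truncated_height_pairing_bound:
  assumes h: "h \<in> augmentation_ideal G \<omega>" and eps: "0 < \<epsilon>"
  shows "\<exists>C\<ge>0. \<forall>L D. 0 \<le> L \<longrightarrow> (\<forall>u\<in>carrier G. min (height u) L \<le> D * \<omega> u) \<longrightarrow>
    (\<forall>a\<in>l1 G \<omega>. cmod (\<Sum>\<^sub>\<infinity>u\<in>carrier G. convolution G a h u * complex_of_real (min (height u) L))
       \<le> weighted_norm a * (C + \<epsilon> * D))"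
proof -
  have hl1: "h \<in> l1 G \<omega>" and h0: "(\<Sum>\<^sub>\<infinity>u\<in>carrier G. h u) = 0"
    using h by (auto simp: augmentation_ideal_def)
  let ?n = "\<lambda>w. cmod (h w) * \<omega> w"
  obtain F where F: "finite F" "F \<subseteq> carrier G" and close: "dist (sum ?n F) (infsum ?n (carrier G)) \<le> \<epsilon>"
    using infsum_finite_approximation[OF l1_summable[OF hl1] eps] by blast
  define R where "R = (\<Sum>\<^sub>\<infinity>w\<in>carrier G - F. ?n w)"
  have sR: "?n summable_on carrier G - F"
    by (rule summable_on_subset_banach[OF l1_summable[OF hl1]]) auto
  have "infsum ?n (carrier G - F) = infsum ?n (carrier G) - infsum ?n F"
    using F by (intro infsum_Diff l1_summable hl1) auto
  then have R: "R \<le> \<epsilon>"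
    using close F by (simp add: R_def dist_real_def)
  have "\<forall>w\<in>carrier G. \<exists>c\<ge>0. \<forall>v\<in>carrier G. \<bar>height (v \<otimes> w) - height v\<bar> \<le> c * \<omega> v"
    using height_mult by blast
  then obtain c where c0: "\<And>w. w \<in> carrier G \<Longrightarrow> 0 \<le> c w"
    and c: "\<And>w v. w \<in> carrier G \<Longrightarrow> v \<in> carrier G \<Longrightarrow> \<bar>height (v \<otimes> w) - height v\<bar> \<le> c w * \<omega> v"
    by metis
  define C where "C = (\<Sum>w\<in>F. cmod (h w) * c w)"
  have "0 \<le> C"
    unfolding C_def using c0 F by (intro sum_nonneg mult_nonneg_nonneg) auto
  moreover have "cmod (\<Sum>\<^sub>\<infinity>u\<in>carrier G. convolution G a h u * complex_of_real (min (height u) L))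
       \<le> weighted_norm a * (C + \<epsilon> * D)"
    if L: "0 \<le> L" and D: "\<And>u. u \<in> carrier G \<Longrightarrow> min (height u) L \<le> D * \<omega> u" and a: "a \<in> l1 G \<omega>" for L D a
  proof -
    define \<sigma> where "\<sigma> u = min (height u) L" for u
    have \<sigma>0: "0 \<le> \<sigma> u" for u
      using height_nonneg L by (simp add: \<sigma>_def)
    have \<sigma>D: "\<sigma> u \<le> D * \<omega> u" if "u \<in> carrier G" for u
      using D[OF that] by (simp add: \<sigma>_def)
    have D0: "0 \<le> D"
      using \<sigma>D[of \<one>] \<sigma>0[of \<one>] by simp
    define inner where "inner v = (\<Sum>\<^sub>\<infinity>w\<in>carrier G. h w * complex_of_real (\<sigma> (v \<otimes> w)))" for v
    have inner: "cmod (inner v) \<le> (C + \<epsilon> * D) * \<omega> v" if v: "v \<in> carrier G" for v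
    proof -
      have dom: "cmod (complex_of_real (\<sigma> (v \<otimes> w))) \<le> (D * \<omega> v) * \<omega> w" if w: "w \<in> carrier G" for w
      proof -
        have "\<sigma> (v \<otimes> w) \<le> D * \<omega> (v \<otimes> w)" using \<sigma>D v w by simp
        also have "\<dots> \<le> D * (\<omega> v * \<omega> w)" using weight_mult v w D0 by (intro mult_left_mono) auto
        finally show ?thesis using \<sigma>0 by simp
      qed
      have s: "((\<lambda>w. h w * complex_of_real (\<sigma> (v \<otimes> w))) has_sum inner v) (carrier G)"
        unfolding inner_def
        by (rule has_sum_infsum, rule abs_summable_summable, rule l1_times_dominated_summable[OF hl1 dom])
      have "((\<lambda>w. h w * complex_of_real (\<sigma> v)) has_sum 0 * complex_of_real (\<sigma> v)) (carrier G)"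
        using has_sum_infsum[OF l1_sum_summable[OF hl1]] h0 by (intro has_sum_cmult_left) simp
      from has_sum_add[OF s has_sum_uminusI[OF this]]
      have diff: "((\<lambda>w. h w * complex_of_real (\<sigma> (v \<otimes> w) - \<sigma> v)) has_sum inner v) (carrier G)"
        by (simp add: right_diff_distrib)
      define q where "q w = (if w \<in> F then cmod (h w) * c w * \<omega> v else D * \<omega> v * ?n w)" for w
      have "(q has_sum C * \<omega> v) F"
        unfolding C_def sum_distrib_right by (rule has_sum_finiteI) (use F in \<open>auto simp: q_def\<close>)
      moreover have "(q has_sum D * \<omega> v * R) (carrier G - F)"
      proof -
        have "((\<lambda>w. D * \<omega> v * ?n w) has_sum D * \<omega> v * R) (carrier G - F)"
          unfolding R_def by (rule has_sum_cmult_right[OF has_sum_infsum[OF sR]])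
        then show ?thesis
          by (rule has_sum_cong[THEN iffD1, rotated]) (auto simp: q_def)
      qed
      ultimately have "(q has_sum C * \<omega> v + D * \<omega> v * R) (F \<union> (carrier G - F))"
        by (rule has_sum_Un_disjoint) auto
      moreover have "F \<union> (carrier G - F) = carrier G" using F by auto
      ultimately have q: "(q has_sum C * \<omega> v + D * \<omega> v * R) (carrier G)" by simp
      have "cmod (inner v) \<le> C * \<omega> v + D * \<omega> v * R"
      proof (rule norm_infsum_le[OF diff q])
        fix w assume w: "w \<in> carrier G"
        \<comment> \<open>Both values lie between zero and the same bound, so no factor 2 arises off \<open>F\<close>.\<close>
        have "\<bar>\<sigma> (v \<otimes> w) - \<sigma> v\<bar> \<le> (if w \<in> F then c w * \<omega> v else D * \<omega> v * \<omega> w)"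
        proof (cases "w \<in> F")
          case True
          have "\<bar>\<sigma> (v \<otimes> w) - \<sigma> v\<bar> \<le> \<bar>height (v \<otimes> w) - height v\<bar>"
            unfolding \<sigma>_def by linarith
          then show ?thesis using c[OF w v] True by simp
        next
          case False
          have "\<sigma> v \<le> D * \<omega> v * 1" using \<sigma>D[OF v] by simp
          also have "\<dots> \<le> D * \<omega> v * \<omega> w"
            using weight_ge_1[OF w] D0 weight_nonneg[OF v] by (intro mult_left_mono) auto
          finally have "\<sigma> v \<le> D * \<omega> v * \<omega> w" .
          then show ?thesis using dom[OF w] \<sigma>0[of v] \<sigma>0[of "v \<otimes> w"] False by simp
        qed
        from mult_left_mono[OF this, of "cmod (h w)"]
        show "cmod (h w * complex_of_real (\<sigma> (v \<otimes> w) - \<sigma> v)) \<le> q w"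
          unfolding norm_mult norm_of_real by (simp add: q_def ac_simps split: if_splits)
      qed
      also have "\<dots> \<le> C * \<omega> v + D * \<omega> v * \<epsilon>"
        using R D0 weight_nonneg[OF v] by (intro add_left_mono mult_left_mono) auto
      finally show ?thesis by (simp add: algebra_simps)
    qed
    have "(\<Sum>\<^sub>\<infinity>u\<in>carrier G. convolution G a h u * complex_of_real (\<sigma> u)) = (\<Sum>\<^sub>\<infinity>v\<in>carrier G. a v * inner v)"
      unfolding inner_def by (rule convolution_pairing[OF a hl1, of _ D]) (use \<sigma>D \<sigma>0 in simp)
    moreover have "cmod (\<Sum>\<^sub>\<infinity>v\<in>carrier G. a v * inner v) \<le> weighted_norm a * (C + \<epsilon> * D)"
    proof (rule norm_infsum_le)
      show "((\<lambda>v. a v * inner v) has_sum (\<Sum>\<^sub>\<infinity>v\<in>carrier G. a v * inner v)) (carrier G)"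
        by (rule has_sum_infsum, rule abs_summable_summable, rule l1_times_dominated_summable[OF a inner])
      show "((\<lambda>v. cmod (a v) * \<omega> v * (C + \<epsilon> * D)) has_sum weighted_norm a * (C + \<epsilon> * D)) (carrier G)"
        unfolding weighted_norm_def by (rule has_sum_cmult_left[OF has_sum_infsum[OF l1_summable[OF a]]])
      fix v assume v: "v \<in> carrier G"
      show "cmod (a v * inner v) \<le> cmod (a v) * \<omega> v * (C + \<epsilon> * D)"
        using mult_left_mono[OF inner[OF v], of "cmod (a v)"] by (simp add: norm_mult ac_simps)
    qed
    ultimately show ?thesis by (simp add: \<sigma>_def)
  qed
  ultimately show ?thesis by blast
qed

text \<open>
  Here \<open>D\<close> is the norm of the functional given by the height truncated at \<open>L\<close>, a supremum that is finite
  because of the truncation, and \<open>g\<close> attains it up to a factor 2. Truncating at the height of a point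
  with large ratio makes the norm large.
\<close>

lemma unbounded_truncation_ratio:
  assumes unb: "\<And>Q. \<exists>m\<ge>1. Q * \<tau> m < lower_sum \<tau> m"
  shows "\<exists>L D g. 0 \<le> L \<and> B \<le> D \<and> 0 < D \<and> g \<in> carrier G \<and>
    (\<forall>u\<in>carrier G. min (height u) L \<le> D * \<omega> u) \<and> D * \<omega> g \<le> 2 * min (height g) L"
proof -
  define Q where "Q = max 1 B"
  obtain m where m: "m \<ge> 1" "Q * \<tau> m < lower_sum \<tau> m" using unb by blast
  obtain u0 where u0: "u0 \<in> carrier G" "len u0 = m"
    using word_sphere_nonempty[OF infinite_group] by blast
  define L where "L = height u0"
  define r where "r u = min (height u) L / \<omega> u" for u
  define D where "D = (SUP u\<in>carrier G. r u)"
  have L0: "0 \<le> L" by (simp add: L_def height_nonneg)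
  have pos: "0 < \<omega> u" if "u \<in> carrier G" for u
    using weight_ge_1[OF that] by simp
  have "r u \<le> L" if "u \<in> carrier G" for u
  proof -
    have "L * 1 \<le> L * \<omega> u"
      using weight_ge_1[OF that] L0 by (intro mult_left_mono) auto
    then show ?thesis using pos[OF that] by (simp add: r_def divide_le_eq)
  qed
  then have bdd: "bdd_above (r ` carrier G)" by (rule bdd_aboveI2)
  have rD: "r u \<le> D" if "u \<in> carrier G" for u
    unfolding D_def by (rule cSUP_upper[OF that bdd])
  have "Q * \<omega> u0 < height u0"
    using m u0 weight_eq_len by (simp add: height_def)
  then have "Q < r u0"
    using pos[OF u0(1)] by (simp add: r_def L_def pos_less_divide_eq)
  with rD[OF u0(1)] have "Q < D" by simp
  then have D: "0 < D" "B \<le> D" by (auto simp: Q_def)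
  have "D / 2 < D" using D by simp
  then obtain g where g: "g \<in> carrier G" "D / 2 < r g"
    unfolding D_def using less_cSUP_iff[OF _ bdd] carrier_not_empty by blast
  have "D * \<omega> g \<le> 2 * min (height g) L"
    using g(2) pos[OF g(1)] by (simp add: r_def field_simps)
  moreover have "min (height u) L \<le> D * \<omega> u" if "u \<in> carrier G" for u
    using rD[OF that] pos[OF that] unfolding r_def by (simp add: pos_divide_le_eq)
  ultimately show ?thesis using L0 D g(1) by blast
qed

text \<open>
  At stage \<open>k\<close> the truncation is chosen such that the constants of \<open>truncated_height_pairing_bound\<close> for
  \<open>\<epsilon> = (1/8) ^ k\<close> are absorbed by \<open>(1/8) ^ k * D k\<close>. The function \<open>f\<close> pairs with it to at least
  \<open>(1/2) ^ k * D k / 2\<close>, yet a combination of the generators with coefficients of total norm \<open>N\<close> yields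
  at most \<open>2 * N * (1/8) ^ k * D k\<close>. This fails for large \<open>k\<close>.
\<close>

lemma finitely_generated_imp_lower_sum_bound:
  assumes "finitely_generated_left_ideal (augmentation_ideal G \<omega>) (l1_algebra G \<omega>)"
  shows "\<exists>C. \<forall>m\<ge>1. lower_sum \<tau> m \<le> C * \<tau> m"
proof (rule ccontr)
  assume "\<not> ?thesis"
  then have unb: "\<exists>m\<ge>1. Q * \<tau> m < lower_sum \<tau> m" for Q
    by (meson linorder_not_le)
  obtain n :: nat and h where h: "\<And>i. i \<in> {1..n} \<Longrightarrow> h i \<in> augmentation_ideal G \<omega>"
    and gen: "\<And>f. f \<in> augmentation_ideal G \<omega> \<Longrightarrow>
      \<exists>a. (\<forall>i\<in>{1..n}. a i \<in> l1 G \<omega>) \<and> f = (\<lambda>u. \<Sum>i\<in>{1..n}. convolution G (a i) (h i) u)"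
    using augmentation_ideal_finitely_generatedE[OF assms] by blast
  define bounds where "bounds k i c \<longleftrightarrow> 0 \<le> c \<and>
    (\<forall>L D. 0 \<le> L \<longrightarrow> (\<forall>u\<in>carrier G. min (height u) L \<le> D * \<omega> u) \<longrightarrow>
    (\<forall>a\<in>l1 G \<omega>. cmod (\<Sum>\<^sub>\<infinity>u\<in>carrier G. convolution G a (h i) u * complex_of_real (min (height u) L))
       \<le> weighted_norm a * (c + (1/8) ^ k * D)))" for k i c
  have "\<exists>c. bounds k i c" if "i \<in> {1..n}" for k i
    unfolding bounds_def using truncated_height_pairing_bound[OF h[OF that], of "(1/8) ^ k"] by simp
  moreover define C where "C k i = (SOME c. bounds k i c)" for k i
  ultimately have C: "bounds k i (C k i)" if "i \<in> {1..n}" for k i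
    using that by (simp add: someI_ex)
  define B where "B k = 8 ^ k * (\<Sum>i\<in>{1..n}. C k i)" for k :: nat
  define extremal where "extremal k L D g \<longleftrightarrow> 0 \<le> L \<and> B k \<le> D \<and> 0 < D \<and> g \<in> carrier G \<and>
    (\<forall>u\<in>carrier G. min (height u) L \<le> D * \<omega> u) \<and> D * \<omega> g \<le> 2 * min (height g) L" for k L D g
  have "\<exists>L D g. extremal k L D g" for k
    unfolding extremal_def by (rule unbounded_truncation_ratio[OF unb])
  then obtain L D g where ext: "\<And>k. extremal k (L k) (D k) (g k)"
    by metis
  then have L: "\<And>k. 0 \<le> L k" and BD: "\<And>k. B k \<le> D k" and D: "\<And>k. 0 < D k"
    and g: "\<And>k. g k \<in> carrier G"
    and \<sigma>D: "\<And>k. \<forall>u\<in>carrier G. min (height u) (L k) \<le> D k * \<omega> u"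
    and big: "\<And>k. D k * \<omega> (g k) \<le> 2 * min (height (g k)) (L k)"
    unfolding extremal_def by simp_all
  obtain y where y0: "\<And>u. 0 \<le> y u" and ys: "(\<lambda>u. y u * \<omega> u) summable_on carrier G"
    and yr: "\<And>u. u \<notin> range g \<Longrightarrow> y u = 0" and yg: "\<And>k. (1/2) ^ k \<le> y (g k) * \<omega> (g k)"
    using weighted_summable_slowly_along_sequence[of g "carrier G" \<omega>] g weight_ge_1 by blast
  have yout: "y u = 0" if "u \<notin> carrier G" for u
    by (rule yr) (use that g in auto)
  have yl1: "(\<lambda>u. complex_of_real (y u)) \<in> l1 G \<omega>"
    by (rule l1I[OF _ ys]) (simp_all add: yout abs_of_nonneg[OF y0])
  define s where "s = (\<Sum>\<^sub>\<infinity>u\<in>carrier G. complex_of_real (y u))"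
  define f where "f u = complex_of_real (y u) - s * point \<one> u" for u
  have "f \<in> l1 G \<omega>"
    unfolding f_def by (intro l1_diff yl1 l1_scale l1_point one_closed)
  moreover have "(f has_sum s + - s) (carrier G)"
    using has_sum_add[OF has_sum_infsum[OF l1_sum_summable[OF yl1]] has_sum_uminusI[OF has_sum_point[OF one_closed, of s]]]
    unfolding f_def s_def by simp
  ultimately have "f \<in> augmentation_ideal G \<omega>"
    by (simp add: augmentation_ideal_def infsumI)
  then obtain a where a: "\<And>i. i \<in> {1..n} \<Longrightarrow> a i \<in> l1 G \<omega>"
    and fa: "f = (\<lambda>u. \<Sum>i\<in>{1..n}. convolution G (a i) (h i) u)"
    using gen by blast
  define N where "N = (\<Sum>i\<in>{1..n}. weighted_norm (a i))"
  have "4 ^ k \<le> 4 * N" for k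
  proof -
    define \<sigma> where "\<sigma> u = min (height u) (L k)" for u
    have \<sigma>0: "0 \<le> \<sigma> u" for u
      using height_nonneg L by (simp add: \<sigma>_def)
    \<comment> \<open>The correction of \<open>f\<close> at the identity is invisible to the pairing.\<close>
    have \<sigma>1: "\<sigma> \<one> = 0" using L by (simp add: \<sigma>_def)
    have dom: "cmod (complex_of_real (\<sigma> u)) \<le> D k * \<omega> u" if "u \<in> carrier G" for u
      using \<sigma>D[of k] \<sigma>0 that by (simp add: \<sigma>_def)
    have sum_conv: "(\<lambda>u. convolution G (a i) (h i) u * complex_of_real (\<sigma> u)) summable_on carrier G"
      if "i \<in> {1..n}" for i
      using convolution_l1[OF a[OF that]] h[OF that]
      by (intro abs_summable_summable[OF l1_times_dominated_summable[OF _ dom]])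
         (auto simp: augmentation_ideal_def)
    have "(\<Sum>\<^sub>\<infinity>u\<in>carrier G. f u * complex_of_real (\<sigma> u))
        = (\<Sum>i\<in>{1..n}. \<Sum>\<^sub>\<infinity>u\<in>carrier G. convolution G (a i) (h i) u * complex_of_real (\<sigma> u))"
      unfolding fa sum_distrib_right
      by (rule infsumI, rule has_sum_finite_sum, simp, rule has_sum_infsum, rule sum_conv)
    also have "cmod \<dots> \<le> (\<Sum>i\<in>{1..n}. weighted_norm (a i) * (2 * (1/8) ^ k * D k))"
    proof (rule sum_norm_le)
      fix i assume i: "i \<in> {1..n}"
      have "C k i \<le> (\<Sum>i\<in>{1..n}. C k i)"
        using i C[of _ k] by (intro member_le_sum) (auto simp: bounds_def)
      also have "\<dots> = (1/8) ^ k * B k"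
        by (simp add: B_def power_one_over)
      also have "\<dots> \<le> (1/8) ^ k * D k"
        using BD by (intro mult_left_mono) auto
      finally have "C k i + (1/8) ^ k * D k \<le> 2 * (1/8) ^ k * D k" by linarith
      moreover have "cmod (\<Sum>\<^sub>\<infinity>u\<in>carrier G. convolution G (a i) (h i) u * complex_of_real (\<sigma> u))
          \<le> weighted_norm (a i) * (C k i + (1/8) ^ k * D k)"
        unfolding \<sigma>_def
        by (rule C[OF i, unfolded bounds_def, THEN conjunct2, THEN spec, THEN spec, THEN mp, OF L,
              THEN mp, OF \<sigma>D, THEN bspec, OF a[OF i]])
      ultimately show "cmod (\<Sum>\<^sub>\<infinity>u\<in>carrier G. convolution G (a i) (h i) u * complex_of_real (\<sigma> u))
          \<le> weighted_norm (a i) * (2 * (1/8) ^ k * D k)"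
        using mult_left_mono weighted_norm_nonneg order_trans by fast
    qed
    also have "\<dots> = N * (2 * (1/8) ^ k * D k)"
      by (simp only: N_def sum_distrib_right)
    finally have upper: "cmod (\<Sum>\<^sub>\<infinity>u\<in>carrier G. f u * complex_of_real (\<sigma> u)) \<le> N * (2 * (1/8) ^ k * D k)" .
    have ysig: "(\<lambda>u. y u * \<sigma> u) summable_on carrier G"
    proof (rule summable_on_comparison_test)
      show "(\<lambda>u. D k * (y u * \<omega> u)) summable_on carrier G"
        by (rule summable_on_cmult_right[OF ys])
      show "y u * \<sigma> u \<le> D k * (y u * \<omega> u)" if "u \<in> carrier G" for u
        using mult_left_mono[OF dom[OF that] y0[of u]] \<sigma>0 by (simp add: ac_simps)
    qed (simp add: y0 \<sigma>0)
    have "(\<lambda>u. f u * complex_of_real (\<sigma> u)) = (\<lambda>u. complex_of_real (y u * \<sigma> u))"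
      using \<sigma>1 by (auto simp: f_def)
    then have "(\<Sum>\<^sub>\<infinity>u\<in>carrier G. f u * complex_of_real (\<sigma> u)) = complex_of_real (\<Sum>\<^sub>\<infinity>u\<in>carrier G. y u * \<sigma> u)"
      by (simp only: infsumI[OF has_sum_of_real[OF has_sum_infsum[OF ysig]]])
    moreover have "0 \<le> (\<Sum>\<^sub>\<infinity>u\<in>carrier G. y u * \<sigma> u)"
      by (intro infsum_nonneg mult_nonneg_nonneg y0 \<sigma>0)
    ultimately have "(\<Sum>\<^sub>\<infinity>u\<in>carrier G. y u * \<sigma> u) \<le> N * (2 * (1/8) ^ k * D k)"
      using upper by simp
    moreover have "sum (\<lambda>u. y u * \<sigma> u) {g k} \<le> (\<Sum>\<^sub>\<infinity>u\<in>carrier G. y u * \<sigma> u)"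
      by (rule finite_sum_le_infsum[OF ysig]) (use g y0 \<sigma>0 in auto)
    ultimately have 1: "y (g k) * \<sigma> (g k) \<le> N * (2 * (1/8) ^ k * D k)" by simp
    have "(1/2) ^ k * D k \<le> y (g k) * \<omega> (g k) * D k"
      using yg D[of k] by (intro mult_right_mono) auto
    also have "\<dots> = y (g k) * (D k * \<omega> (g k))" by simp
    also have "\<dots> \<le> y (g k) * (2 * \<sigma> (g k))"
      using big[of k] y0 by (intro mult_left_mono) (auto simp: \<sigma>_def)
    also have "\<dots> \<le> 4 * N * (1/8) ^ k * D k" using 1 by (simp add: ac_simps)
    finally have "(1/2) ^ k \<le> 4 * N * (1/8) ^ k"
      using D[of k] by simp
    then have "(1/2) ^ k * 8 ^ k \<le> 4 * N * (1/8) ^ k * (8 ^ k :: real)"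
      by (rule mult_right_mono) simp
    then show ?thesis
      by (simp add: mult.assoc flip: power_mult_distrib)
  qed
  moreover obtain k where "4 * N < 4 ^ k"
    using real_arch_pow[of 4 "4 * N"] by auto
  ultimately show False by (meson linorder_not_le)
qed

end

theorem theorem1p8:
  fixes G :: "('a, 'b) monoid_scheme" (structure)
    and X :: "'a set"
    and \<omega> :: "'a \<Rightarrow> real"
    and \<tau> :: "nat \<Rightarrow> real"
  assumes "group G"
    and "infinite (carrier G)"
    and "X \<subseteq> carrier G"
    and "finite X"
    and "set_inv X = X"
    and "generate G X = carrier G"
    and "weight G \<omega>"
    and "radial G X \<omega>"
    and "\<And>n u. n \<ge> 1 \<Longrightarrow> u \<in> word_sphere G X n \<Longrightarrow> \<omega> u = \<tau> n"
  shows "finitely_generated_left_ideal (augmentation_ideal G \<omega>) (l1_algebra G \<omega>)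
         \<longleftrightarrow> tail_preserving \<tau>"
proof -
  interpret group G by fact
  interpret radially_weighted_group G X \<omega> \<tau>
    by unfold_locales (fact assms)+
  show ?thesis
  proof
    assume "finitely_generated_left_ideal (augmentation_ideal G \<omega>) (l1_algebra G \<omega>)"
    then obtain C where "\<And>m. m \<ge> 1 \<Longrightarrow> lower_sum \<tau> m \<le> C * \<tau> m"
      using finitely_generated_imp_lower_sum_bound by blast
    with sphere_weight_ge_1 show "tail_preserving \<tau>"
      by (rule lower_sum_bound_imp_tail_preserving)
  next
    assume "tail_preserving \<tau>"
    then obtain C where "\<And>m. m \<ge> 1 \<Longrightarrow> lower_sum \<tau> m \<le> C * \<tau> m"
      using tail_preserving_imp_lower_sum_bound by blast
    then show "finitely_generated_left_ideal (augmentation_ideal G \<omega>) (l1_algebra G \<omega>)"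
      by (rule lower_sum_bound_imp_finitely_generated)
  qed
qed

end
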